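(* Let $I\subset\mathbb{R}$ be an open interval, let $A_1,A_2:I\to(0,\infty)$ be smooth functions, and consider on $I\times S^3$ the Riemannian metric $$g=dt^2+A_1^2(t)(e^1)^2+A_2^2(t)\big((e^2)^2+(e^3)^2\big).$$ Suppose that $g$ is Einstein but not Ricci-flat, that $A_1$ and $A_2$ do not coincide, and that there are real constants $k_1,k_2,k_3,l_1,l_2,l_3$ such that $$A_1'=k_1\Big(\frac{A_1}{A_2}\Big)^2+k_2\frac{A_1}{A_2}+k_3,\qquad A_2'=l_1\Big(\frac{A_1}{A_2}\Big)^2+l_2\frac{A_1}{A_2}+l_3 .$$ Then $g$ is isometric to the Fubini-Study metric on $\mathbb{C}P^2$ or to the hyperbolic Fubini-Study metric on $SU(1,2)/S(U(1,1)\times U(1))$, and, up to replacing $(k_1,k_2,k_3,l_1,l_2,l_3)$ by $(-k_1,-k_2,-k_3,-l_1,-l_2,-l_3)$, one has $k_1=2$, $k_2=0$, $k_3=-1$, $l_1=0$, $l_2=1$, $l_3=0$.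
   Context: $S^3$ is the standard 3-sphere with a global frame of 1-forms $\{e^1,e^2,e^3\}$ satisfying $de^i=2e^{i+1}\wedge e^{i+2}$, indices taken mod 3. A prime denotes $d/dt$. Einstein means $\mathrm{Ric}=\lambda g$ for a constant $\lambda$. In this basis, the Fubini-Study metric is (on the open set where these coordinates are defined, and up to a constant scale parametrized by $\alpha>0$, with $\alpha=1$ the classical normalization) the metric $dt^2+A_1^2(e^1)^2+A_2^2((e^2)^2+(e^3)^2)$ with $A_1(t)=\frac{1}{2\alpha}\sin(2\alpha t)$, $A_2(t)=\frac1\alpha\sin(\alpha t)$. The hyperbolic Fubini-Study metric is obtained by replacing $\alpha$ with $\mathfrak{i}\alpha$, i.e. $A_1(t)=\frac{1}{2\alpha}\sinh(2\alpha t)$, $A_2(t)=\frac1\alpha\sinh(\alpha t)$ ($\alpha=1$ giving sectional curvature in $[-4,-1]$). "Isometric to" one of these metrics means isometric for some value of $\alpha$, on the corresponding range of $t$ (up to shift and sign of $t$). *)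

theory Defs
  imports "HOL-Analysis.Analysis"
begin

section \<open>Smooth maps and vector fields on submanifolds of Euclidean space\<close>

primrec Ck_on :: "nat \<Rightarrow> 'a::euclidean_space set \<Rightarrow> ('a \<Rightarrow> 'b::real_normed_vector) \<Rightarrow> bool" where
  "Ck_on 0 U f \<longleftrightarrow> continuous_on U f"
| "Ck_on (Suc k) U f \<longleftrightarrow>
     (\<forall>x\<in>U. f differentiable (at x)) \<and> (\<forall>v. Ck_on k U (\<lambda>x. frechet_derivative f (at x) v))"

definition smooth_map :: "'a::euclidean_space set \<Rightarrow> ('a \<Rightarrow> 'b::real_normed_vector) \<Rightarrow> bool" where
  "smooth_map M f \<longleftrightarrow>
     (\<forall>p\<in>M. \<exists>U F. open U \<and> p \<in> U \<and> (\<forall>k. Ck_on k U F) \<and> (\<forall>q\<in>M \<inter> U. F q = f q))"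

definition tangent_space :: "'a::euclidean_space set \<Rightarrow> 'a \<Rightarrow> 'a set" where
  "tangent_space M p =
     {v. \<exists>\<gamma>::real \<Rightarrow> 'a. \<gamma> 0 = p \<and> (\<forall>\<^sub>F s in at 0. \<gamma> s \<in> M) \<and> (\<gamma> has_vector_derivative v) (at 0)}"

definition vector_field :: "'a::euclidean_space set \<Rightarrow> ('a \<Rightarrow> 'a) \<Rightarrow> bool" where
  "vector_field M X \<longleftrightarrow> smooth_map M X \<and> (\<forall>p\<in>M. X p \<in> tangent_space M p)"

text \<open>
  The differential of \<open>f\<close> at \<open>p \<in> M\<close>.  A derivative within \<open>M\<close> is determined only on tangent
  vectors (by the chain rule along curves in \<open>M\<close>), so it is only ever applied to those.
\<close>

definition differential :: "'a::euclidean_space set \<Rightarrow> ('a \<Rightarrow> 'b::real_normed_vector) \<Rightarrow> 'a \<Rightarrow> 'a \<Rightarrow> 'b" where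
  "differential M f p = frechet_derivative f (at p within M)"

definition lie_bracket :: "'a::euclidean_space set \<Rightarrow> ('a \<Rightarrow> 'a) \<Rightarrow> ('a \<Rightarrow> 'a) \<Rightarrow> 'a \<Rightarrow> 'a" where
  "lie_bracket M X Y p = differential M Y p (X p) - differential M X p (Y p)"


section \<open>One-forms\<close>

definition one_form :: "'a::euclidean_space set \<Rightarrow> ('a \<Rightarrow> 'a \<Rightarrow> real) \<Rightarrow> bool" where
  "one_form M \<omega> \<longleftrightarrow>
     (\<forall>p\<in>M. \<forall>v\<in>tangent_space M p. \<forall>w\<in>tangent_space M p. \<forall>a b.
        \<omega> p (a *\<^sub>R v + b *\<^sub>R w) = a * \<omega> p v + b * \<omega> p w) \<and>
     (\<forall>X. vector_field M X \<longrightarrow> smooth_map M (\<lambda>p. \<omega> p (X p)))"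

definition exterior_derivative ::
  "'a::euclidean_space set \<Rightarrow> ('a \<Rightarrow> 'a \<Rightarrow> real) \<Rightarrow> ('a \<Rightarrow> 'a) \<Rightarrow> ('a \<Rightarrow> 'a) \<Rightarrow> 'a \<Rightarrow> real" where
  "exterior_derivative M \<omega> X Y p =
     differential M (\<lambda>q. \<omega> q (Y q)) p (X p) - differential M (\<lambda>q. \<omega> q (X q)) p (Y p)
       - \<omega> p (lie_bracket M X Y p)"

definition wedge :: "('a \<Rightarrow> 'a \<Rightarrow> real) \<Rightarrow> ('a \<Rightarrow> 'a \<Rightarrow> real) \<Rightarrow> ('a \<Rightarrow> 'a) \<Rightarrow> ('a \<Rightarrow> 'a) \<Rightarrow> 'a \<Rightarrow> real" where
  "wedge \<omega> \<eta> X Y p = \<omega> p (X p) * \<eta> p (Y p) - \<omega> p (Y p) * \<eta> p (X p)"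


section \<open>Levi-Civita connection, Ricci curvature, isometries\<close>

text \<open>
  A field of bilinear forms is a function \<open>g\<close> of a point and two tangent vectors, and a connection
  maps a pair of vector fields \<open>X\<close>, \<open>Y\<close> to the vector field \<open>\<nabla>\<^sub>X Y\<close>.  Vector fields are total
  functions of which only the values on \<open>M\<close> matter.
\<close>

definition affine_connection ::
  "'a::euclidean_space set \<Rightarrow> (('a \<Rightarrow> 'a) \<Rightarrow> ('a \<Rightarrow> 'a) \<Rightarrow> 'a \<Rightarrow> 'a) \<Rightarrow> bool" where
  "affine_connection M D \<longleftrightarrow>
     (\<forall>X Y. vector_field M X \<longrightarrow> vector_field M Y \<longrightarrow> vector_field M (D X Y)) \<and>
     (\<forall>X X' Y. vector_field M X \<longrightarrow> vector_field M X' \<longrightarrow> vector_field M Y \<longrightarrow>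
        (\<forall>p\<in>M. D (\<lambda>q. X q + X' q) Y p = D X Y p + D X' Y p)) \<and>
     (\<forall>f X Y. smooth_map M f \<longrightarrow> vector_field M X \<longrightarrow> vector_field M Y \<longrightarrow>
        (\<forall>p\<in>M. D (\<lambda>q. f q *\<^sub>R X q) Y p = f p *\<^sub>R D X Y p)) \<and>
     (\<forall>X Y Y'. vector_field M X \<longrightarrow> vector_field M Y \<longrightarrow> vector_field M Y' \<longrightarrow>
        (\<forall>p\<in>M. D X (\<lambda>q. Y q + Y' q) p = D X Y p + D X Y' p)) \<and>
     (\<forall>f X Y. smooth_map M f \<longrightarrow> vector_field M X \<longrightarrow> vector_field M Y \<longrightarrow>
        (\<forall>p\<in>M. D X (\<lambda>q. f q *\<^sub>R Y q) p = differential M f p (X p) *\<^sub>R Y p + f p *\<^sub>R D X Y p))"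

definition levi_civita ::
  "'a::euclidean_space set \<Rightarrow> ('a \<Rightarrow> 'a \<Rightarrow> 'a \<Rightarrow> real) \<Rightarrow>
     (('a \<Rightarrow> 'a) \<Rightarrow> ('a \<Rightarrow> 'a) \<Rightarrow> 'a \<Rightarrow> 'a) \<Rightarrow> bool" where
  "levi_civita M g D \<longleftrightarrow>
     affine_connection M D \<and>
     (\<forall>X Y. vector_field M X \<longrightarrow> vector_field M Y \<longrightarrow>
        (\<forall>p\<in>M. D X Y p - D Y X p = lie_bracket M X Y p)) \<and>
     (\<forall>X Y Z. vector_field M X \<longrightarrow> vector_field M Y \<longrightarrow> vector_field M Z \<longrightarrow>
        (\<forall>p\<in>M. differential M (\<lambda>q. g q (Y q) (Z q)) p (X p)
                = g p (D X Y p) (Z p) + g p (Y p) (D X Z p)))"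

definition curvature ::
  "'a::euclidean_space set \<Rightarrow> (('a \<Rightarrow> 'a) \<Rightarrow> ('a \<Rightarrow> 'a) \<Rightarrow> 'a \<Rightarrow> 'a) \<Rightarrow>
     ('a \<Rightarrow> 'a) \<Rightarrow> ('a \<Rightarrow> 'a) \<Rightarrow> ('a \<Rightarrow> 'a) \<Rightarrow> 'a \<Rightarrow> 'a" where
  "curvature M D X Y Z p = D X (D Y Z) p - D Y (D X Z) p - D (lie_bracket M X Y) Z p"

text \<open>
  The trace of an endomorphism of a subspace \<open>V\<close>.  The orthonormal basis refers to the ambient
  Euclidean inner product; the trace does not depend on this choice.
\<close>

definition trace_on :: "'a::euclidean_space set \<Rightarrow> ('a \<Rightarrow> 'a) \<Rightarrow> real" where
  "trace_on V T =
     (let B = (SOME B. B \<subseteq> V \<and> pairwise orthogonal B \<and> (\<forall>b\<in>B. norm b = 1) \<and> span B = V)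
      in \<Sum>b\<in>B. T b \<bullet> b)"

text \<open>
  \<open>Ric(X, Y)\<close> at \<open>p\<close> is the trace of \<open>v \<mapsto> R(v, X)Y\<close> on the tangent space.  As the curvature
  is tensorial, it is immaterial which vector field \<open>Z\<close> with \<open>Z p = v\<close> is used.
\<close>

definition ricci ::
  "'a::euclidean_space set \<Rightarrow> (('a \<Rightarrow> 'a) \<Rightarrow> ('a \<Rightarrow> 'a) \<Rightarrow> 'a \<Rightarrow> 'a) \<Rightarrow>
     ('a \<Rightarrow> 'a) \<Rightarrow> ('a \<Rightarrow> 'a) \<Rightarrow> 'a \<Rightarrow> real" where
  "ricci M D X Y p =
     trace_on (tangent_space M p)
       (\<lambda>v. curvature M D (SOME Z. vector_field M Z \<and> Z p = v) X Y p)"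

text \<open>
  The values on \<open>M\<close> of the Levi-Civita connection of a Riemannian metric are unique, so the
  existential quantifier over \<open>D\<close> below only names it.
\<close>

definition einstein :: "'a::euclidean_space set \<Rightarrow> ('a \<Rightarrow> 'a \<Rightarrow> 'a \<Rightarrow> real) \<Rightarrow> bool" where
  "einstein M g \<longleftrightarrow>
     (\<exists>D c. levi_civita M g D \<and>
        (\<forall>X Y. vector_field M X \<longrightarrow> vector_field M Y \<longrightarrow>
           (\<forall>p\<in>M. ricci M D X Y p = c * g p (X p) (Y p))))"

definition ricci_flat :: "'a::euclidean_space set \<Rightarrow> ('a \<Rightarrow> 'a \<Rightarrow> 'a \<Rightarrow> real) \<Rightarrow> bool" where
  "ricci_flat M g \<longleftrightarrow>
     (\<exists>D. levi_civita M g D \<and>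
        (\<forall>X Y. vector_field M X \<longrightarrow> vector_field M Y \<longrightarrow> (\<forall>p\<in>M. ricci M D X Y p = 0)))"

definition isometry ::
  "'a::euclidean_space set \<Rightarrow> ('a \<Rightarrow> 'a \<Rightarrow> 'a \<Rightarrow> real) \<Rightarrow>
   'b::euclidean_space set \<Rightarrow> ('b \<Rightarrow> 'b \<Rightarrow> 'b \<Rightarrow> real) \<Rightarrow> ('a \<Rightarrow> 'b) \<Rightarrow> bool" where
  "isometry M g N h \<phi> \<longleftrightarrow>
     bij_betw \<phi> M N \<and> smooth_map M \<phi> \<and> smooth_map N (inv_into M \<phi>) \<and>
     (\<forall>p\<in>M. \<forall>v\<in>tangent_space M p. \<forall>w\<in>tangent_space M p.
        h (\<phi> p) (differential M \<phi> p v) (differential M \<phi> p w) = g p v w)"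


section \<open>The metrics on \<open>I \<times> S\<^sup>3\<close>\<close>

abbreviation S3 :: "(real^4) set" where
  "S3 \<equiv> sphere 0 1"

text \<open>
  A global coframe on \<open>S\<^sup>3\<close> with \<open>de\<^sup>i = 2 e\<^sup>i\<^sup>+\<^sup>1 \<and> e\<^sup>i\<^sup>+\<^sup>2\<close>.  The index type \<open>3\<close> is the ring of
  integers modulo 3, so that \<open>i + 1\<close> and \<open>i + 2\<close> are cyclic and \<open>e 3\<close> is \<open>e 0\<close>.
  The bijectivity says that the three forms are a basis of the cotangent space.
\<close>

definition S3_coframe :: "(3 \<Rightarrow> real^4 \<Rightarrow> real^4 \<Rightarrow> real) \<Rightarrow> bool" where
  "S3_coframe e \<longleftrightarrow>
     (\<forall>i. one_form S3 (e i)) \<and>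
     (\<forall>p\<in>S3. bij_betw (\<lambda>v i. e i p v) (tangent_space S3 p) UNIV) \<and>
     (\<forall>i X Y. vector_field S3 X \<longrightarrow> vector_field S3 Y \<longrightarrow>
        (\<forall>p\<in>S3. exterior_derivative S3 (e i) X Y p = 2 * wedge (e (i + 1)) (e (i + 2)) X Y p))"

definition biaxial_metric ::
  "(3 \<Rightarrow> real^4 \<Rightarrow> real^4 \<Rightarrow> real) \<Rightarrow> (real \<Rightarrow> real) \<Rightarrow> (real \<Rightarrow> real) \<Rightarrow>
     real \<times> (real^4) \<Rightarrow> real \<times> (real^4) \<Rightarrow> real \<times> (real^4) \<Rightarrow> real" where
  "biaxial_metric e A\<^sub>1 A\<^sub>2 = (\<lambda>(t, p) (\<tau>, v) (\<sigma>, w).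
     \<tau> * \<sigma> + (A\<^sub>1 t)\<^sup>2 * (e 1 p v * e 1 p w)
       + (A\<^sub>2 t)\<^sup>2 * (e 2 p v * e 2 p w + e 3 p v * e 3 p w))"

text \<open>
  The Fubini-Study metric of scale \<open>\<alpha>\<close>, on \<open>{0<..<pi / (2 * \<alpha>)} \<times> S\<^sup>3\<close>, and the hyperbolic
  Fubini-Study metric, on \<open>{0<..} \<times> S\<^sup>3\<close>.
\<close>

definition fubini_study_metric ::
  "(3 \<Rightarrow> real^4 \<Rightarrow> real^4 \<Rightarrow> real) \<Rightarrow> real \<Rightarrow>
     real \<times> (real^4) \<Rightarrow> real \<times> (real^4) \<Rightarrow> real \<times> (real^4) \<Rightarrow> real" where
  "fubini_study_metric e \<alpha> =
     biaxial_metric e (\<lambda>t. sin (2 * \<alpha> * t) / (2 * \<alpha>)) (\<lambda>t. sin (\<alpha> * t) / \<alpha>)"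

definition hyperbolic_fubini_study_metric ::
  "(3 \<Rightarrow> real^4 \<Rightarrow> real^4 \<Rightarrow> real) \<Rightarrow> real \<Rightarrow>
     real \<times> (real^4) \<Rightarrow> real \<times> (real^4) \<Rightarrow> real \<times> (real^4) \<Rightarrow> real" where
  "hyperbolic_fubini_study_metric e \<alpha> =
     biaxial_metric e (\<lambda>t. sinh (2 * \<alpha> * t) / (2 * \<alpha>)) (\<lambda>t. sinh (\<alpha> * t) / \<alpha>)"

text \<open>
  \<open>g\<close> on \<open>I \<times> S\<^sup>3\<close> becomes \<open>h\<close>, restricted to the values of the radial coordinate that occur and
  that have to lie in \<open>R\<close>, by a shift and possibly a change of sign of \<open>t\<close>.
\<close>

definition isometric_up_to_shift_and_sign ::
  "real set \<Rightarrow> (real \<times> (real^4) \<Rightarrow> real \<times> (real^4) \<Rightarrow> real \<times> (real^4) \<Rightarrow> real) \<Rightarrow>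
   real set \<Rightarrow> (real \<times> (real^4) \<Rightarrow> real \<times> (real^4) \<Rightarrow> real \<times> (real^4) \<Rightarrow> real) \<Rightarrow> bool" where
  "isometric_up_to_shift_and_sign I g R h \<longleftrightarrow>
     (\<exists>s\<in>{1, -1}. \<exists>c. (\<lambda>t. s * t + c) ` I \<subseteq> R \<and>
        isometry (I \<times> S3) g (((\<lambda>t. s * t + c) ` I) \<times> S3) h (\<lambda>(t, p). (s * t + c, p)))"

end

theory Submission
  imports Defs
begin

text \<open>
  Let \<open>E\<^sub>i\<close> be the frame of \<open>S\<^sup>3\<close> dual to the given coframe and \<open>T = \<partial>/\<partial>t\<close>.  In the frame \<open>T, E\<^sub>1, E\<^sub>2, E\<^sub>3\<close>
  the Koszul formula gives the connection, and hence \<open>Ric(T, T)\<close> and \<open>Ric(E\<^sub>i, E\<^sub>i)\<close>, in terms of \<open>A\<^sub>1\<close>, \<open>A\<^sub>2\<close>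
  and their derivatives.  With \<open>x = A\<^sub>1 / A\<^sub>2\<close>, \<open>A\<^sub>1' = K(x)\<close> and \<open>A\<^sub>2' = L(x)\<close> we have \<open>x' = (K(x) - x L(x)) / A\<^sub>2\<close>,
  so the Einstein equations express \<open>c A\<^sub>2\<^sup>2\<close> in three ways as a rational function of \<open>x\<close>.  If \<open>x\<close> were
  constant, then \<open>A\<^sub>1'' = A\<^sub>2'' = 0\<close> and so \<open>c = 0\<close>.  Otherwise \<open>x\<close> takes infinitely many values, and comparing
  coefficients leaves, apart from Ricci-flat solutions, only \<open>K(x) = \<plusminus>(2 x\<^sup>2 - 1)\<close>, \<open>L(x) = \<plusminus>x\<close> and
  \<open>c A\<^sub>2\<^sup>2 = 6 (1 - x\<^sup>2)\<close>.  Hence \<open>arcsin (\<alpha> A\<^sub>2)\<close> or \<open>arsinh (\<alpha> A\<^sub>2)\<close>, where \<open>\<alpha>\<^sup>2 = \<bar>c\<bar> / 6\<close>, is affine in \<open>t\<close>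
  with slope \<open>\<plusminus>\<alpha>\<close>.
\<close>

section \<open>Calculus of smooth maps on subsets of Euclidean space\<close>

text \<open>Several obstacles shape the proof. The coframe is an arbitrary solution of the structure
  equations, so its dual frame is only a pointwise inverse; an auxiliary global frame of quaternion
  multiplications and Cramer's rule make it smooth. Next, \<open>curvature\<close> acts on total
  functions and \<open>ricci\<close> feeds it an arbitrarily chosen extension of a tangent vector.
  Independence of that choice requires that the connection ignores values off the manifold and that
  the curvature is linear over functions in its first slot; only then can the trace be taken in the
  frame. Three radial functions are carried instead of two, because the structure equations are
  invariant under cyclic shifts of the index and one formula then serves all three directions.
  Finally, equality of the three polynomial expressions alone does not determine the coefficients:
  \<open>K x = x^2\<close>, \<open>L x = 2 - x\<close> (Taub-NUT) and \<open>K x = 2 - x^2\<close>,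
  \<open>L x = x\<close> (Eguchi-Hanson) satisfy it as well, with common value zero. Nonvanishing of
  that value has to enter the comparison of coefficients.\<close>

lemma Ck_on_subset: "Ck_on k U f \<Longrightarrow> V \<subseteq> U \<Longrightarrow> Ck_on k V f"
  by (induction k arbitrary: f) (auto intro: continuous_on_subset)

lemma frechet_derivative_cong_open:
  assumes "open U" "x \<in> U" "\<And>y. y \<in> U \<Longrightarrow> f y = g y"
  shows "frechet_derivative f (at x) = frechet_derivative g (at x)"
    and "f differentiable (at x) \<longleftrightarrow> g differentiable (at x)"
proof -
  have *: "(f has_derivative d) (at x) \<longleftrightarrow> (g has_derivative d) (at x)" for d
    using has_derivative_transform_within_open[of f d x UNIV U g]
      has_derivative_transform_within_open[of g d x UNIV U f] assms by auto
  show "frechet_derivative f (at x) = frechet_derivative g (at x)"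
    by (simp add: frechet_derivative_def *)
  show "f differentiable (at x) \<longleftrightarrow> g differentiable (at x)"
    by (simp add: differentiable_def *)
qed

lemma Ck_on_cong:
  assumes "open U" "\<And>x. x \<in> U \<Longrightarrow> f x = g x"
  shows "Ck_on k U f \<longleftrightarrow> Ck_on k U g"
  using assms(2)
proof (induction k arbitrary: f g)
  case 0
  then show ?case by (auto cong: continuous_on_cong)
next
  case (Suc k)
  note fd = frechet_derivative_cong_open[OF assms(1), of _ f g]
  have 1: "(\<forall>x\<in>U. f differentiable (at x)) \<longleftrightarrow> (\<forall>x\<in>U. g differentiable (at x))"
    using fd(2) Suc.prems by blast
  have 2: "Ck_on k U (\<lambda>x. frechet_derivative f (at x) v)
      \<longleftrightarrow> Ck_on k U (\<lambda>x. frechet_derivative g (at x) v)" for v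
  proof (rule Suc.IH)
    fix x assume "x \<in> U"
    then show "frechet_derivative f (at x) v = frechet_derivative g (at x) v"
      using fd(1)[of x] Suc.prems by simp
  qed
  show ?case unfolding Ck_on.simps using 1 2 by blast
qed

lemma Ck_on_Suc_imp: "Ck_on (Suc k) U f \<Longrightarrow> Ck_on k U f"
proof (induction k arbitrary: f)
  case 0
  then show ?case
    by (simp add: differentiable_imp_continuous_on differentiable_on_def differentiable_at_withinI)
next
  case (Suc k)
  have d: "\<forall>x\<in>U. f differentiable (at x)" and "\<And>v. Ck_on (Suc k) U (\<lambda>x. frechet_derivative f (at x) v)"
    using Suc.prems by simp_all
  then have "\<And>v. Ck_on k U (\<lambda>x. frechet_derivative f (at x) v)" using Suc.IH by blast
  then show ?case using d by simp
qed

lemma Ck_on_const: "Ck_on k U (\<lambda>x. c)"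
  by (induction k arbitrary: c) (auto simp: frechet_derivative_const)

text \<open>\<open>frechet_derivative\<close> is a choice operator. Uniqueness of derivatives on an
  open set allows any explicit family \<open>d x\<close> in its place.\<close>

lemma Ck_on_SucI:
  assumes "open U" "\<And>x. x \<in> U \<Longrightarrow> (f has_derivative d x) (at x)" "\<And>v. Ck_on k U (\<lambda>x. d x v)"
  shows "Ck_on (Suc k) U f"
proof -
  have "frechet_derivative f (at x) v = d x v" if "x \<in> U" for x v
    using frechet_derivative_at[OF assms(2)[OF that]] by simp
  then have "Ck_on k U (\<lambda>x. frechet_derivative f (at x) v)" for v
    using iffD1[OF Ck_on_cong[OF assms(1), of "\<lambda>x. d x v" "\<lambda>x. frechet_derivative f (at x) v" k]] assms(3)[of v]
    by presburger
  then show ?thesis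
    using assms(2) unfolding Ck_on.simps differentiable_def by blast
qed

lemma Ck_on_SucD:
  assumes "Ck_on (Suc k) U f" "x \<in> U"
  shows "(f has_derivative frechet_derivative f (at x)) (at x)"
  using assms by (simp flip: frechet_derivative_works)

lemma Ck_on_add:
  assumes "open U" "Ck_on k U f" "Ck_on k U g"
  shows "Ck_on k U (\<lambda>x. f x + g x)"
  using assms(2,3)
proof (induction k arbitrary: f g)
  case 0
  then show ?case by (auto intro: continuous_intros)
next
  case (Suc k)
  show ?case
    by (rule Ck_on_SucI[OF assms(1) has_derivative_add[OF Ck_on_SucD[OF Suc.prems(1)] Ck_on_SucD[OF Suc.prems(2)]]])
      (use Suc in auto)
qed

lemma Ck_on_bilinear:
  assumes "open U" "bounded_bilinear b" "Ck_on k U f" "Ck_on k U g"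
  shows "Ck_on k U (\<lambda>x. b (f x) (g x))"
  using assms(3,4)
proof (induction k arbitrary: f g)
  case 0
  then show ?case using bounded_bilinear.continuous_on[OF assms(2)] by auto
next
  case (Suc k)
  \<comment> \<open>The product rule pairs an undifferentiated factor with a differentiated one, so
    the induction hypothesis needs the factors themselves at level \<open>k\<close> as well.\<close>
  have fg: "Ck_on k U f" "Ck_on k U g" using Suc.prems Ck_on_Suc_imp by auto
  show ?case
    by (rule Ck_on_SucI[OF assms(1) bounded_bilinear.FDERIV[OF assms(2) Ck_on_SucD[OF Suc.prems(1)] Ck_on_SucD[OF Suc.prems(2)]]])
      (use Suc fg in \<open>auto intro!: Ck_on_add[OF assms(1)]\<close>)
qed

lemma Ck_on_linear_left:
  assumes "open U" "bounded_linear L" "Ck_on k U f"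
  shows "Ck_on k U (\<lambda>x. L (f x))"
  using assms(3)
proof (induction k arbitrary: f)
  case 0
  then show ?case using bounded_linear.continuous_on[OF assms(2)] by auto
next
  case (Suc k)
  show ?case
    by (rule Ck_on_SucI[OF assms(1) bounded_linear.has_derivative[OF assms(2) Ck_on_SucD[OF Suc.prems]]])
      (use Suc in auto)
qed

text \<open>With a linear inner map, the derivative in direction \<open>v\<close> is again a
  composite with \<open>L\<close>, now of the derivative of \<open>f\<close> in the fixed direction
  \<open>L v\<close>. The induction thus closes without a general chain rule for C^k maps.\<close>

lemma Ck_on_linear_right:
  assumes "open U" "open V" "bounded_linear L" "Ck_on k U f" "L ` V \<subseteq> U"
  shows "Ck_on k V (\<lambda>x. f (L x))"
  using assms(4)
proof (induction k arbitrary: f)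
  case 0
  then show ?case
    using continuous_on_compose2[of U f V L] assms(5) linear_continuous_on[OF assms(3)] by auto
next
  case (Suc k)
  have "((\<lambda>x. f (L x)) has_derivative (\<lambda>v. frechet_derivative f (at (L x)) (L v))) (at x)" if "x \<in> V" for x
    using has_derivative_compose[OF bounded_linear_imp_has_derivative[OF assms(3)] Ck_on_SucD[OF Suc.prems]]
      that assms(5) by blast
  then show ?case
    by (rule Ck_on_SucI[OF assms(2)]) (use Suc in auto)
qed

lemma Ck_on_linear:
  assumes "open U" "bounded_linear L"
  shows "Ck_on k U L"
proof (cases k)
  case 0
  then show ?thesis using linear_continuous_on[OF assms(2)] by auto
next
  case (Suc m)
  then show ?thesis
    using Ck_on_SucI[OF assms(1) bounded_linear_imp_has_derivative[OF assms(2)] Ck_on_const] by simp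
qed

lemma Ck_on_inverse:
  fixes f :: "'a::euclidean_space \<Rightarrow> real"
  assumes "open U" "Ck_on k U f" "\<And>x. x \<in> U \<Longrightarrow> f x \<noteq> 0"
  shows "Ck_on k U (\<lambda>x. inverse (f x))"
  using assms(2)
proof (induction k)
  case 0
  then show ?case using assms by (auto intro!: continuous_intros)
next
  case (Suc k)
  have 1: "Ck_on k U (\<lambda>x. inverse (f x))" using Suc Ck_on_Suc_imp by blast
  have "((\<lambda>x. inverse (f x)) has_derivative
      (\<lambda>h. - (inverse (f x) * frechet_derivative f (at x) h * inverse (f x)))) (at x)" if "x \<in> U" for x
    by (rule Deriv.has_derivative_inverse[OF assms(3)[OF that] Ck_on_SucD[OF Suc.prems that]])
  then show ?case
  proof (rule Ck_on_SucI[OF assms(1)])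
    fix v
    show "Ck_on k U (\<lambda>x. - (inverse (f x) * frechet_derivative f (at x) v * inverse (f x)))"
      using Suc.prems 1
      by (intro Ck_on_linear_left[OF assms(1) bounded_linear_minus[OF bounded_linear_ident]]
          Ck_on_bilinear[OF assms(1) bounded_bilinear_mult]) auto
  qed
qed

section \<open>Smooth maps on arbitrary subsets through local extensions\<close>

lemma smooth_mapE:
  assumes "smooth_map M f" "p \<in> M"
  obtains U F where "open U" "p \<in> U" "\<And>k. Ck_on k U F" "\<And>q. q \<in> M \<Longrightarrow> q \<in> U \<Longrightarrow> F q = f q"
  using assms unfolding smooth_map_def by fastforce

lemma smooth_mapI:
  assumes "\<And>p. p \<in> M \<Longrightarrow> \<exists>U F. open U \<and> p \<in> U \<and> (\<forall>k. Ck_on k U F) \<and> (\<forall>q\<in>M \<inter> U. F q = f q)"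
  shows "smooth_map M f"
  using assms unfolding smooth_map_def by blast

lemma smooth_map_cong:
  assumes "smooth_map M f" "\<And>p. p \<in> M \<Longrightarrow> f p = g p"
  shows "smooth_map M g"
  using assms unfolding smooth_map_def by (metis IntD1)

lemma smooth_map_local:
  assumes "\<And>p. p \<in> M \<Longrightarrow> \<exists>U. open U \<and> p \<in> U \<and> smooth_map (M \<inter> U) f"
  shows "smooth_map M f"
proof (rule smooth_mapI)
  fix p assume p: "p \<in> M"
  obtain U where U: "open U" "p \<in> U" "smooth_map (M \<inter> U) f" using assms[OF p] by blast
  obtain V F where V: "open V" "p \<in> V" "\<And>k. Ck_on k V F" "\<And>q. q \<in> M \<inter> U \<Longrightarrow> q \<in> V \<Longrightarrow> F q = f q"
    using smooth_mapE[OF U(3), of p] p U(2) by blast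
  show "\<exists>U F. open U \<and> p \<in> U \<and> (\<forall>k. Ck_on k U F) \<and> (\<forall>q\<in>M \<inter> U. F q = f q)"
    using U V Ck_on_subset[of _ V F "U \<inter> V"]
    by (intro exI[of _ "U \<inter> V"] exI[of _ F]) auto
qed

lemma smooth_map_Ck: "open U \<Longrightarrow> (\<And>k. Ck_on k U F) \<Longrightarrow> M \<subseteq> U \<Longrightarrow> smooth_map M F"
  by (rule smooth_mapI) blast

lemma smooth_map_const [simp]: "smooth_map M (\<lambda>x. c)"
  by (rule smooth_map_Ck[of UNIV]) (auto simp: Ck_on_const)

lemma smooth_map_linear: "bounded_linear L \<Longrightarrow> smooth_map M L"
  by (rule smooth_map_Ck[of UNIV]) (auto simp: Ck_on_linear)

lemma smooth_map_linear_left: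
  assumes "bounded_linear L" "smooth_map M f"
  shows "smooth_map M (\<lambda>x. L (f x))"
proof (rule smooth_mapI)
  fix p assume "p \<in> M"
  then obtain U F where "open U" "p \<in> U" "\<And>k. Ck_on k U F" "\<And>q. q \<in> M \<Longrightarrow> q \<in> U \<Longrightarrow> F q = f q"
    using smooth_mapE[OF assms(2)] by metis
  then show "\<exists>U F. open U \<and> p \<in> U \<and> (\<forall>k. Ck_on k U F) \<and> (\<forall>q\<in>M \<inter> U. F q = L (f q))"
    using Ck_on_linear_left[OF _ assms(1), of U _ F] by (intro exI[of _ U] exI[of _ "\<lambda>x. L (F x)"]) auto
qed

lemma smooth_map_linear_right:
  assumes "bounded_linear L" "smooth_map N f" "L ` M \<subseteq> N"
  shows "smooth_map M (\<lambda>x. f (L x))"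
proof (rule smooth_mapI)
  fix p assume p: "p \<in> M"
  then obtain U F where U: "open U" "L p \<in> U" "\<And>k. Ck_on k U F" "\<And>q. q \<in> N \<Longrightarrow> q \<in> U \<Longrightarrow> F q = f q"
    using smooth_mapE[OF assms(2), of "L p"] assms(3) by (metis image_subset_iff)
  have "open (L -` U)"
    using U(1) assms(1) by (simp add: continuous_open_vimage linear_continuous_at)
  then show "\<exists>U F. open U \<and> p \<in> U \<and> (\<forall>k. Ck_on k U F) \<and> (\<forall>q\<in>M \<inter> U. F q = f (L q))"
    using U assms(3) Ck_on_linear_right[OF U(1) _ assms(1) U(3), of "L -` U"]
    by (intro exI[of _ "L -` U"] exI[of _ "\<lambda>x. F (L x)"]) auto
qed

lemma smooth_map_bilinear:
  assumes "bounded_bilinear b" "smooth_map M f" "smooth_map M g"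
  shows "smooth_map M (\<lambda>x. b (f x) (g x))"
proof (rule smooth_mapI)
  fix p assume p: "p \<in> M"
  then obtain U F where U: "open U" "p \<in> U" "\<And>k. Ck_on k U F" "\<And>q. q \<in> M \<Longrightarrow> q \<in> U \<Longrightarrow> F q = f q"
    using smooth_mapE[OF assms(2)] by metis
  obtain V G where V: "open V" "p \<in> V" "\<And>k. Ck_on k V G" "\<And>q. q \<in> M \<Longrightarrow> q \<in> V \<Longrightarrow> G q = g q"
    using smooth_mapE[OF assms(3) p] by metis
  have "Ck_on k (U \<inter> V) (\<lambda>x. b (F x) (G x))" for k
    using U V by (intro Ck_on_bilinear[OF _ assms(1)]) (auto intro: Ck_on_subset)
  then show "\<exists>U F. open U \<and> p \<in> U \<and> (\<forall>k. Ck_on k U F) \<and> (\<forall>q\<in>M \<inter> U. F q = b (f q) (g q))"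
    using U V by (intro exI[of _ "U \<inter> V"] exI[of _ "\<lambda>x. b (F x) (G x)"]) auto
qed

lemma smooth_map_add:
  assumes "smooth_map M f" "smooth_map M g"
  shows "smooth_map M (\<lambda>x. f x + g x)"
proof (rule smooth_mapI)
  fix p assume p: "p \<in> M"
  then obtain U F where U: "open U" "p \<in> U" "\<And>k. Ck_on k U F" "\<And>q. q \<in> M \<Longrightarrow> q \<in> U \<Longrightarrow> F q = f q"
    using smooth_mapE[OF assms(1)] by metis
  obtain V G where V: "open V" "p \<in> V" "\<And>k. Ck_on k V G" "\<And>q. q \<in> M \<Longrightarrow> q \<in> V \<Longrightarrow> G q = g q"
    using smooth_mapE[OF assms(2) p] by metis
  have "Ck_on k (U \<inter> V) (\<lambda>x. F x + G x)" for k
    using U V by (intro Ck_on_add) (auto intro: Ck_on_subset)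
  then show "\<exists>U F. open U \<and> p \<in> U \<and> (\<forall>k. Ck_on k U F) \<and> (\<forall>q\<in>M \<inter> U. F q = f q + g q)"
    using U V by (intro exI[of _ "U \<inter> V"] exI[of _ "\<lambda>x. F x + G x"]) auto
qed

lemma smooth_map_minus: "smooth_map M f \<Longrightarrow> smooth_map M (\<lambda>x. - f x)"
  by (rule smooth_map_linear_left[OF bounded_linear_minus[OF bounded_linear_ident]])

lemma smooth_map_diff: "smooth_map M f \<Longrightarrow> smooth_map M g \<Longrightarrow> smooth_map M (\<lambda>x. f x - g x)"
  using smooth_map_add[OF _ smooth_map_minus, of M f g] by simp

lemmas smooth_map_scaleR = smooth_map_bilinear[OF bounded_bilinear_scaleR]
  and smooth_map_mult = smooth_map_bilinear[OF bounded_bilinear_mult]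
  and smooth_map_inner = smooth_map_bilinear[OF bounded_bilinear_inner]

lemma smooth_map_sum:
  "(\<And>i. i \<in> S \<Longrightarrow> smooth_map M (f i)) \<Longrightarrow> smooth_map M (\<lambda>x. \<Sum>i\<in>S. f i x)"
  by (induction S rule: infinite_finite_induct) (auto intro: smooth_map_add)

lemma smooth_map_power:
  fixes f :: "'a::euclidean_space \<Rightarrow> real"
  shows "smooth_map M f \<Longrightarrow> smooth_map M (\<lambda>x. f x ^ n)"
  by (induction n) (auto intro: smooth_map_mult)

lemma smooth_map_inverse:
  fixes f :: "'a::euclidean_space \<Rightarrow> real"
  assumes "smooth_map M f" "\<And>x. x \<in> M \<Longrightarrow> f x \<noteq> 0"
  shows "smooth_map M (\<lambda>x. inverse (f x))"
proof (rule smooth_mapI)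
  fix p assume p: "p \<in> M"
  then obtain U F where U: "open U" "p \<in> U" "\<And>k. Ck_on k U F" "\<And>q. q \<in> M \<Longrightarrow> q \<in> U \<Longrightarrow> F q = f q"
    using smooth_mapE[OF assms(1)] by metis
  have "continuous_on U F" using U(3)[of 0] by simp
  \<comment> \<open>The local extension \<open>F\<close> may vanish off \<open>M\<close>, so the
    neighbourhood is shrunk to where it does not.\<close>
  then have o: "open (U \<inter> F -` (- {0}))"
    using U(1) by (intro continuous_open_preimage) auto
  have "Ck_on k (U \<inter> F -` (- {0})) (\<lambda>x. inverse (F x))" for k
    by (rule Ck_on_inverse[OF o]) (auto intro: Ck_on_subset[OF U(3)])
  then show "\<exists>U F. open U \<and> p \<in> U \<and> (\<forall>k. Ck_on k U F) \<and> (\<forall>q\<in>M \<inter> U. F q = inverse (f q))"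
    using U p assms(2) o by (intro exI[of _ "U \<inter> F -` (- {0})"] exI[of _ "\<lambda>x. inverse (F x)"]) auto
qed

lemma smooth_map_divide:
  fixes f g :: "'a::euclidean_space \<Rightarrow> real"
  shows "smooth_map M f \<Longrightarrow> smooth_map M g \<Longrightarrow> (\<And>x. x \<in> M \<Longrightarrow> g x \<noteq> 0) \<Longrightarrow> smooth_map M (\<lambda>x. f x / g x)"
  unfolding divide_inverse by (intro smooth_map_mult smooth_map_inverse)

lemmas smooth_intros = smooth_map_const smooth_map_add smooth_map_diff smooth_map_minus smooth_map_scaleR
  smooth_map_mult smooth_map_inner smooth_map_sum smooth_map_power smooth_map_divide

section \<open>Differentials on tangent vectors\<close>

lemma has_derivative_transform_within_open_set:
  assumes "p \<in> M" "open U" "p \<in> U" "(F has_derivative d) (at p within M)"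
    "\<And>q. q \<in> M \<Longrightarrow> q \<in> U \<Longrightarrow> F q = f q"
  shows "(f has_derivative d) (at p within M)"
proof -
  obtain e where "e > 0" "ball p e \<subseteq> U" using assms(2,3) openE by blast
  then show ?thesis
    using has_derivative_transform_within[OF assms(4), of e f] assms(1,5)
    by (auto simp: dist_commute subset_iff)
qed

text \<open>The curve is known to lie in \<open>M\<close> only for nonzero parameters close to 0,
  hence the restriction to an open \<open>S\<close>; the parameter 0 itself is covered by
  \<open>\<gamma> 0 = p\<close>.\<close>

lemma has_derivative_along_curve:
  assumes "(f has_derivative f') (at p within M)" "p \<in> M" "\<gamma> 0 = p" "\<forall>\<^sub>F s in at 0. \<gamma> s \<in> M"
    "(\<gamma> has_vector_derivative v) (at 0)"
  shows "((\<lambda>s. f (\<gamma> s)) has_vector_derivative f' v) (at (0::real))"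
proof -
  obtain S where S: "open S" "0 \<in> S" "\<And>s. s \<in> S \<Longrightarrow> s \<noteq> 0 \<Longrightarrow> \<gamma> s \<in> M"
    using assms(4) unfolding eventually_at_topological by auto
  have "(\<gamma> has_derivative (\<lambda>s. s *\<^sub>R v)) (at 0 within S)"
    using assms(5) has_derivative_at_withinI unfolding has_vector_derivative_def by blast
  moreover have "\<gamma> ` S \<subseteq> M" using S(3) assms(2,3) by force
  then have "(f has_derivative f') (at (\<gamma> 0) within \<gamma> ` S)"
    using assms(1,3) has_derivative_subset by blast
  ultimately have "((\<lambda>s. f (\<gamma> s)) has_derivative (\<lambda>s. f' (s *\<^sub>R v))) (at 0 within S)"
    using has_derivative_in_compose by blast
  then have "((\<lambda>s. f (\<gamma> s)) has_derivative (\<lambda>s. f' (s *\<^sub>R v))) (at 0)"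
    using S has_derivative_at_within at_within_open by metis
  then show ?thesis
    using has_derivative_linear[OF assms(1)] by (simp add: has_vector_derivative_def linear_cmul)
qed

text \<open>A derivative within \<open>M\<close> is in general not unique as a linear map. On a
  tangent vector, however, every such derivative returns the velocity of \<open>f\<close> along one
  and the same curve, so the choice made in \<open>differential\<close> is invisible.\<close>

lemma differential_eq:
  assumes "(f has_derivative f') (at p within M)" "p \<in> M" "v \<in> tangent_space M p"
  shows "differential M f p v = f' v"
proof -
  obtain \<gamma> :: "real \<Rightarrow> 'a" where \<gamma>: "\<gamma> 0 = p" "\<forall>\<^sub>F s in at 0. \<gamma> s \<in> M" "(\<gamma> has_vector_derivative v) (at 0)"
    using assms(3) unfolding tangent_space_def by auto
  have "(f has_derivative frechet_derivative f (at p within M)) (at p within M)"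
    using assms(1) by (metis differentiableI frechet_derivative_works)
  from has_derivative_along_curve[OF this assms(2) \<gamma>] has_derivative_along_curve[OF assms(1,2) \<gamma>]
  show ?thesis unfolding differential_def using vector_derivative_unique_at by blast
qed

lemma smooth_map_has_derivative:
  assumes "smooth_map M f" "p \<in> M"
  shows "(f has_derivative differential M f p) (at p within M)"
proof -
  obtain U F where U: "open U" "p \<in> U" "\<And>k. Ck_on k U F" "\<And>q. q \<in> M \<Longrightarrow> q \<in> U \<Longrightarrow> F q = f q"
    using smooth_mapE[OF assms] by metis
  have "(F has_derivative frechet_derivative F (at p)) (at p within M)"
    using Ck_on_SucD[OF U(3) U(2)] has_derivative_at_withinI by blast
  then have "(f has_derivative frechet_derivative F (at p)) (at p within M)"
    using U assms(2) by (auto intro: has_derivative_transform_within_open_set)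
  then show ?thesis
    unfolding differential_def by (metis differentiableI frechet_derivative_works)
qed

text \<open>Near a point the differential agrees on tangent vectors with the Frechet derivative of a
  smooth extension \<open>F\<close>. Expanding \<open>X q\<close> in the standard basis leaves a
  finite sum of products of smooth functions.\<close>

lemma smooth_map_differential:
  assumes f: "smooth_map M f" and X: "vector_field M X"
  shows "smooth_map M (\<lambda>q. differential M f q (X q))"
proof (rule smooth_map_local)
  fix p assume p: "p \<in> M"
  obtain U F where U: "open U" "p \<in> U" "\<And>k. Ck_on k U F" "\<And>q. q \<in> M \<Longrightarrow> q \<in> U \<Longrightarrow> F q = f q"
    using smooth_mapE[OF f p] by metis
  have X': "smooth_map (M \<inter> U) X"
    using X unfolding vector_field_def smooth_map_def by blast
  have "smooth_map (M \<inter> U) (\<lambda>q. frechet_derivative F (at q) b)" for b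
    using U(3)[of "Suc _"] by (intro smooth_map_Ck[OF U(1)]) auto
  then have "smooth_map (M \<inter> U) (\<lambda>q. \<Sum>b\<in>Basis. (X q \<bullet> b) *\<^sub>R frechet_derivative F (at q) b)"
    using X' by (intro smooth_intros)
  moreover have "(\<Sum>b\<in>Basis. (X q \<bullet> b) *\<^sub>R frechet_derivative F (at q) b) = differential M f q (X q)"
    if q: "q \<in> M \<inter> U" for q
  proof -
    have d: "(F has_derivative frechet_derivative F (at q)) (at q)"
      using Ck_on_SucD[OF U(3)] q by blast
    then have "(F has_derivative frechet_derivative F (at q)) (at q within M)"
      using has_derivative_at_withinI by blast
    then have "(f has_derivative frechet_derivative F (at q)) (at q within M)"
      using U q by (auto intro: has_derivative_transform_within_open_set)
    then have "differential M f q (X q) = frechet_derivative F (at q) (X q)"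
      using differential_eq q X unfolding vector_field_def by blast
    also have "\<dots> = (\<Sum>b\<in>Basis. (X q \<bullet> b) *\<^sub>R frechet_derivative F (at q) b)"
      using euclidean_representation[of "X q"] linear_sum[OF has_derivative_linear[OF d], of "\<lambda>b. (X q \<bullet> b) *\<^sub>R b" Basis]
      by (simp add: linear_cmul[OF has_derivative_linear[OF d]])
    finally show ?thesis by simp
  qed
  ultimately show "\<exists>U. open U \<and> p \<in> U \<and> smooth_map (M \<inter> U) (\<lambda>q. differential M f q (X q))"
    using U smooth_map_cong[of "M \<inter> U" _ "\<lambda>q. differential M f q (X q)"] by (intro exI[of _ U]) simp
qed

lemma differential_cong:
  assumes "p \<in> M" "\<And>q. q \<in> M \<Longrightarrow> f q = g q"
  shows "differential M f p = differential M g p"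
proof -
  have "(f has_derivative d) (at p within M) \<longleftrightarrow> (g has_derivative d) (at p within M)" for d
    using assms has_derivative_transform[OF assms(1), of g f d] has_derivative_transform[OF assms(1), of f g d]
    by metis
  then show ?thesis by (simp add: differential_def frechet_derivative_def)
qed

lemma differential_const:
  assumes "p \<in> M" "\<And>q. q \<in> M \<Longrightarrow> f q = c" "v \<in> tangent_space M p"
  shows "differential M f p v = 0"
  using differential_cong[OF assms(1), of f "\<lambda>_. c"] differential_eq[of "\<lambda>_. c" "\<lambda>_. 0"] assms by auto

section \<open>Connections and curvature in a global frame\<close>

lemma vector_field_cong: "vector_field M X \<Longrightarrow> (\<And>p. p \<in> M \<Longrightarrow> X p = Y p) \<Longrightarrow> vector_field M Y"
  unfolding vector_field_def using smooth_map_cong by metis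

text \<open>A global frame with its dual coframe. Linearity of \<open>\<theta>\<close> is demanded
  only on tangent vectors, because one-forms are unconstrained elsewhere.\<close>

locale framed =
  fixes M :: "'a::euclidean_space set" and E :: "'i::finite \<Rightarrow> 'a \<Rightarrow> 'a" and \<theta> :: "'i \<Rightarrow> 'a \<Rightarrow> 'a \<Rightarrow> real"
  assumes subspace_tangent: "p \<in> M \<Longrightarrow> subspace (tangent_space M p)"
    and frame: "vector_field M (E i)"
    and coframe_linear: "\<lbrakk>p \<in> M; v \<in> tangent_space M p; w \<in> tangent_space M p\<rbrakk>
      \<Longrightarrow> \<theta> i p (a *\<^sub>R v + b *\<^sub>R w) = a * \<theta> i p v + b * \<theta> i p w"
    and coframe_frame: "p \<in> M \<Longrightarrow> \<theta> i p (E j p) = (if i = j then 1 else 0)"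
    and frame_expansion: "\<lbrakk>p \<in> M; v \<in> tangent_space M p\<rbrakk> \<Longrightarrow> (\<Sum>i\<in>UNIV. \<theta> i p v *\<^sub>R E i p) = v"
    and coframe_smooth: "vector_field M X \<Longrightarrow> smooth_map M (\<lambda>q. \<theta> i q (X q))"
begin

lemma vector_field_add: "vector_field M X \<Longrightarrow> vector_field M Y \<Longrightarrow> vector_field M (\<lambda>q. X q + Y q)"
  unfolding vector_field_def by (auto intro: smooth_map_add subspace_add[OF subspace_tangent])

lemma vector_field_scaleR: "smooth_map M f \<Longrightarrow> vector_field M X \<Longrightarrow> vector_field M (\<lambda>q. f q *\<^sub>R X q)"
  unfolding vector_field_def by (auto intro: smooth_map_scaleR subspace_scale[OF subspace_tangent])

lemma vector_field_zero: "vector_field M (\<lambda>q. 0)"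
  unfolding vector_field_def by (auto intro: subspace_0[OF subspace_tangent])

lemma vector_field_diff: "vector_field M X \<Longrightarrow> vector_field M Y \<Longrightarrow> vector_field M (\<lambda>q. X q - Y q)"
  unfolding vector_field_def by (auto intro: smooth_map_diff subspace_diff[OF subspace_tangent])

lemma vector_field_sum:
  "(\<And>i. i \<in> S \<Longrightarrow> vector_field M (X i)) \<Longrightarrow> vector_field M (\<lambda>q. \<Sum>i\<in>S. X i q)"
  by (induction S rule: infinite_finite_induct) (auto intro: vector_field_add vector_field_zero)

lemma coframe_add:
  "\<lbrakk>p \<in> M; v \<in> tangent_space M p; w \<in> tangent_space M p\<rbrakk> \<Longrightarrow> \<theta> i p (v + w) = \<theta> i p v + \<theta> i p w"
  using coframe_linear[of p v w i 1 1] by simp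

lemma coframe_scaleR:
  "\<lbrakk>p \<in> M; v \<in> tangent_space M p\<rbrakk> \<Longrightarrow> \<theta> i p (a *\<^sub>R v) = a * \<theta> i p v"
  using coframe_linear[of p v v i a 0] by simp

lemma coframe_zero: "p \<in> M \<Longrightarrow> \<theta> i p 0 = 0"
  using coframe_scaleR[of p 0 i 0] subspace_0[OF subspace_tangent] by simp

lemma coframe_sum:
  "\<lbrakk>p \<in> M; \<And>j. j \<in> S \<Longrightarrow> v j \<in> tangent_space M p\<rbrakk> \<Longrightarrow> \<theta> i p (\<Sum>j\<in>S. v j) = (\<Sum>j\<in>S. \<theta> i p (v j))"
  by (induction S rule: infinite_finite_induct)
    (auto simp: coframe_zero coframe_add subspace_sum[OF subspace_tangent])

lemma frame_tangent: "p \<in> M \<Longrightarrow> E i p \<in> tangent_space M p"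
  using frame unfolding vector_field_def by blast

end

locale framed_connection = framed M E \<theta>
  for M :: "'a::euclidean_space set" and E :: "'i::finite \<Rightarrow> 'a \<Rightarrow> 'a" and \<theta> +
  fixes g :: "'a \<Rightarrow> 'a \<Rightarrow> 'a \<Rightarrow> real" and D
  assumes levi_civita: "levi_civita M g D"
begin

lemma D_field: "vector_field M X \<Longrightarrow> vector_field M Y \<Longrightarrow> vector_field M (D X Y)"
  and D_add1: "\<lbrakk>vector_field M X; vector_field M X'; vector_field M Y; p \<in> M\<rbrakk>
    \<Longrightarrow> D (\<lambda>q. X q + X' q) Y p = D X Y p + D X' Y p"
  and D_scaleR1: "\<lbrakk>smooth_map M f; vector_field M X; vector_field M Y; p \<in> M\<rbrakk>
    \<Longrightarrow> D (\<lambda>q. f q *\<^sub>R X q) Y p = f p *\<^sub>R D X Y p"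
  and D_add2: "\<lbrakk>vector_field M X; vector_field M Y; vector_field M Y'; p \<in> M\<rbrakk>
    \<Longrightarrow> D X (\<lambda>q. Y q + Y' q) p = D X Y p + D X Y' p"
  and D_scaleR2: "\<lbrakk>smooth_map M f; vector_field M X; vector_field M Y; p \<in> M\<rbrakk>
    \<Longrightarrow> D X (\<lambda>q. f q *\<^sub>R Y q) p = differential M f p (X p) *\<^sub>R Y p + f p *\<^sub>R D X Y p"
  and D_torsion: "\<lbrakk>vector_field M X; vector_field M Y; p \<in> M\<rbrakk> \<Longrightarrow> lie_bracket M X Y p = D X Y p - D Y X p"
  and D_metric: "\<lbrakk>vector_field M X; vector_field M Y; vector_field M Z; p \<in> M\<rbrakk>
    \<Longrightarrow> differential M (\<lambda>q. g q (Y q) (Z q)) p (X p) = g p (D X Y p) (Z p) + g p (Y p) (D X Z p)"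
  using levi_civita unfolding levi_civita_def affine_connection_def by simp_all

text \<open>
  A field vanishing on \<open>M\<close> is fixed by multiplication with the indicator of the complement of \<open>M\<close>,
  a smooth function on \<open>M\<close>; this shows that \<open>D\<close> ignores the values outside \<open>M\<close>.
\<close>

lemma D_vanishing:
  assumes "vector_field M Z" "\<And>q. q \<in> M \<Longrightarrow> Z q = 0" "vector_field M X" "p \<in> M"
  shows "D Z X p = 0" "D X Z p = 0"
proof -
  define f where "f = (\<lambda>q. if q \<in> M then 0 else 1::real)"
  have f: "smooth_map M f" by (rule smooth_map_cong[of M "\<lambda>_. 0"]) (auto simp: f_def)
  have Z: "(\<lambda>q. f q *\<^sub>R Z q) = Z" using assms(2) by (auto simp: f_def)
  have fp: "f p = 0" using assms(4) by (simp add: f_def)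
  show "D Z X p = 0" using D_scaleR1[OF f assms(1,3,4)] by (simp add: Z fp)
  have "differential M f p (X p) = 0"
    using assms(3,4) unfolding vector_field_def by (intro differential_const[of _ _ _ 0]) (auto simp: f_def)
  then show "D X Z p = 0" using D_scaleR2[OF f assms(3,1,4)] by (simp add: Z fp)
qed

text \<open>Additivity reduces the claim to the difference of the two fields, which vanishes on
  \<open>M\<close>.\<close>

lemma D_cong1:
  assumes "vector_field M X" "vector_field M Y" "\<And>q. q \<in> M \<Longrightarrow> X q = X' q" "p \<in> M"
  shows "D X' Y p = D X Y p"
proof -
  have X': "vector_field M X'" using vector_field_cong assms(1,3) by blast
  have "D (\<lambda>q. X q + (X' q - X q)) Y p = D X Y p + D (\<lambda>q. X' q - X q) Y p"
    by (intro D_add1 vector_field_diff assms X')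
  also have "D (\<lambda>q. X' q - X q) Y p = 0"
    using assms X' by (intro D_vanishing) (auto intro: vector_field_diff)
  finally show ?thesis by simp
qed

lemma D_cong2:
  assumes "vector_field M X" "vector_field M Y" "\<And>q. q \<in> M \<Longrightarrow> Y q = Y' q" "p \<in> M"
  shows "D X Y' p = D X Y p"
proof -
  have Y': "vector_field M Y'" using vector_field_cong assms(2,3) by blast
  have "D X (\<lambda>q. Y q + (Y' q - Y q)) p = D X Y p + D X (\<lambda>q. Y' q - Y q) p"
    by (intro D_add2 vector_field_diff assms Y')
  also have "D X (\<lambda>q. Y' q - Y q) p = 0"
    using assms Y' by (intro D_vanishing) (auto intro: vector_field_diff)
  finally show ?thesis by simp
qed

lemma D_diff1:
  assumes "vector_field M X" "vector_field M X'" "vector_field M Y" "p \<in> M"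
  shows "D (\<lambda>q. X q - X' q) Y p = D X Y p - D X' Y p"
  using D_add1[OF vector_field_diff[OF assms(1,2)] assms(2,3,4)] by (simp add: eq_diff_eq)

lemma bracket_field: "vector_field M X \<Longrightarrow> vector_field M Y \<Longrightarrow> vector_field M (lie_bracket M X Y)"
  by (rule vector_field_cong[of _ "\<lambda>q. D X Y q - D Y X q"]) (auto simp: D_torsion intro: vector_field_diff D_field)

section \<open>Tensoriality of the curvature in its first argument\<close>

lemma curvature_tangent:
  assumes "vector_field M X" "vector_field M Y" "vector_field M Z" "p \<in> M"
  shows "curvature M D X Y Z p \<in> tangent_space M p"
proof -
  have "vector_field M (\<lambda>p. D X (D Y Z) p - D Y (D X Z) p - D (lie_bracket M X Y) Z p)"
    using assms by (intro vector_field_diff D_field bracket_field)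
  then show ?thesis using assms(4) unfolding vector_field_def curvature_def by blast
qed

lemma curvature_add:
  assumes X: "vector_field M X" "vector_field M X'" and Y: "vector_field M Y" and Z: "vector_field M Z"
    and p: "p \<in> M"
  shows "curvature M D (\<lambda>q. X q + X' q) Y Z p = curvature M D X Y Z p + curvature M D X' Y Z p"
proof -
  note F = X Y Z D_field bracket_field vector_field_add
  have "D Y (D (\<lambda>q. X q + X' q) Z) p = D Y (\<lambda>q. D X Z q + D X' Z q) p"
    by (rule D_cong2) (use F p D_add1 in auto)
  also have "\<dots> = D Y (D X Z) p + D Y (D X' Z) p" using F p by (intro D_add2) auto
  finally have 1: "D Y (D (\<lambda>q. X q + X' q) Z) p = D Y (D X Z) p + D Y (D X' Z) p" .
  have "D (lie_bracket M (\<lambda>q. X q + X' q) Y) Z p = D (\<lambda>q. lie_bracket M X Y q + lie_bracket M X' Y q) Z p"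
    by (rule D_cong1) (use F p D_torsion D_add1 D_add2 in auto)
  also have "\<dots> = D (lie_bracket M X Y) Z p + D (lie_bracket M X' Y) Z p" using F p by (intro D_add1) auto
  finally show ?thesis using 1 D_add1[OF X D_field[OF Y Z] p] by (simp add: curvature_def)
qed

text \<open>The derivative of \<open>f\<close> along \<open>Y\<close> appears twice: in the Leibniz
  rule for \<open>D Y\<close> applied to \<open>f\<close> times \<open>D X Z\<close>, and in
  \<open>[f X, Y] = f [X, Y] - (Y f) X\<close>. The two contributions cancel.\<close>

lemma curvature_scaleR:
  assumes f: "smooth_map M f" and X: "vector_field M X" and Y: "vector_field M Y" and Z: "vector_field M Z"
    and p: "p \<in> M"
  shows "curvature M D (\<lambda>q. f q *\<^sub>R X q) Y Z p = f p *\<^sub>R curvature M D X Y Z p"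
proof -
  define df where "df = (\<lambda>q. differential M f q (Y q))"
  have df: "smooth_map M df" unfolding df_def by (rule smooth_map_differential[OF f Y])
  note F = f df X Y Z D_field bracket_field vector_field_scaleR vector_field_diff
  have "D Y (D (\<lambda>q. f q *\<^sub>R X q) Z) p = D Y (\<lambda>q. f q *\<^sub>R D X Z q) p"
    by (rule D_cong2) (use F p D_scaleR1 in auto)
  also have "\<dots> = df p *\<^sub>R D X Z p + f p *\<^sub>R D Y (D X Z) p"
    using F p D_scaleR2 by (auto simp: df_def)
  finally have 1: "D Y (D (\<lambda>q. f q *\<^sub>R X q) Z) p = df p *\<^sub>R D X Z p + f p *\<^sub>R D Y (D X Z) p" .
  have "D (lie_bracket M (\<lambda>q. f q *\<^sub>R X q) Y) Z p = D (\<lambda>q. f q *\<^sub>R lie_bracket M X Y q - df q *\<^sub>R X q) Z p"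
    by (rule D_cong1) (use F p in \<open>auto simp: D_torsion D_scaleR1 D_scaleR2 df_def algebra_simps\<close>)
  also have "\<dots> = f p *\<^sub>R D (lie_bracket M X Y) Z p - df p *\<^sub>R D X Z p"
    using F p by (simp add: D_diff1 D_scaleR1)
  finally show ?thesis using 1 D_scaleR1[OF f X D_field[OF Y Z] p] by (simp add: curvature_def algebra_simps)
qed

lemma curvature_cong:
  assumes X: "vector_field M X" and Y: "vector_field M Y" and Z: "vector_field M Z"
    and eq: "\<And>q. q \<in> M \<Longrightarrow> X q = X' q" and p: "p \<in> M"
  shows "curvature M D X' Y Z p = curvature M D X Y Z p"
proof -
  note F = X Y Z D_field bracket_field
  have X': "vector_field M X'" using vector_field_cong[OF X eq] .
  have *: "D X' W q = D X W q" "D W X' q = D W X q" if "vector_field M W" "q \<in> M" for W q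
    using D_cong1[OF X that(1) eq that(2)] D_cong2[OF that(1) X eq that(2)] by auto
  have "D Y (D X' Z) p = D Y (D X Z) p"
    by (rule D_cong2) (use F p * in auto)
  moreover have "D (lie_bracket M X' Y) Z p = D (lie_bracket M X Y) Z p"
    by (rule D_cong1) (use F X' p * D_torsion in auto)
  ultimately show ?thesis using * F p by (simp add: curvature_def)
qed

lemma curvature_sum:
  assumes "finite S" "\<And>i. i \<in> S \<Longrightarrow> vector_field M (X i)" "vector_field M Y" "vector_field M Z" "p \<in> M"
  shows "curvature M D (\<lambda>q. \<Sum>i\<in>S. X i q) Y Z p = (\<Sum>i\<in>S. curvature M D (X i) Y Z p)"
  using assms(1,2)
proof (induction S rule: finite_induct)
  case empty
  have "curvature M D (\<lambda>q. 0) Y Z p = 0"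
    using curvature_scaleR[OF smooth_map_const vector_field_zero assms(3-5), of 0] by simp
  then show ?case by simp
next
  case (insert i S)
  then show ?case using curvature_add[OF _ vector_field_sum assms(3-5), of "X i" S X] by simp
qed

text \<open>The value depends on \<open>X\<close> only through \<open>X p\<close>, which makes the
  extension chosen in \<open>ricci\<close> harmless. A field equals its frame expansion only on
  \<open>M\<close>, hence the detour through \<open>curvature_cong\<close>.\<close>

lemma curvature_frame:
  assumes "vector_field M X" "vector_field M Y" "vector_field M Z" "p \<in> M"
  shows "curvature M D X Y Z p = (\<Sum>i\<in>UNIV. \<theta> i p (X p) *\<^sub>R curvature M D (E i) Y Z p)"
proof -
  let ?X = "\<lambda>q. \<Sum>i\<in>UNIV. \<theta> i q (X q) *\<^sub>R E i q"
  have f: "vector_field M (\<lambda>q. \<theta> i q (X q) *\<^sub>R E i q)" for i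
    by (intro vector_field_scaleR coframe_smooth frame assms)
  have "curvature M D ?X Y Z p = curvature M D X Y Z p"
    using assms frame_expansion unfolding vector_field_def
    by (intro curvature_cong) (auto simp: vector_field_def)
  moreover have "curvature M D ?X Y Z p = (\<Sum>i\<in>UNIV. curvature M D (\<lambda>q. \<theta> i q (X q) *\<^sub>R E i q) Y Z p)"
    by (intro curvature_sum f assms finite)
  ultimately show ?thesis
    using curvature_scaleR[OF coframe_smooth frame] assms by simp
qed

text \<open>Independence of the trace from the basis: expanding each curvature vector in the ambient
  orthonormal basis \<open>B\<close> and exchanging the two sums turns the trace over
  \<open>B\<close> into the trace over the frame.\<close>

lemma ricci_frame:
  assumes X: "vector_field M X" and Y: "vector_field M Y" and p: "p \<in> M"
  shows "ricci M D X Y p = (\<Sum>i\<in>UNIV. \<theta> i p (curvature M D (E i) X Y p))"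
proof -
  let ?V = "tangent_space M p" and ?R = "\<lambda>i. curvature M D (E i) X Y p"
  let ?ON = "\<lambda>B. B \<subseteq> ?V \<and> pairwise orthogonal B \<and> (\<forall>b\<in>B. norm b = 1) \<and> span B = ?V"
  define B where "B = (SOME B. ?ON B)"
  have "?ON B" unfolding B_def
    by (rule someI_ex) (use orthonormal_basis_subspace[OF subspace_tangent[OF p]] in metis)
  then have B: "B \<subseteq> ?V" "pairwise orthogonal B" "\<And>b. b \<in> B \<Longrightarrow> norm b = 1" "span B = ?V" by auto
  have finB: "finite B" using B(2) pairwise_orthogonal_imp_finite by blast
  have expand: "(\<Sum>b\<in>B. (v \<bullet> b) *\<^sub>R b) = v" if "v \<in> ?V" for v
    using orthonormal_basis_expand[OF B(2,3) _ finB] that B(4) by metis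
  have R: "?R i \<in> ?V" for i by (rule curvature_tangent[OF frame X Y p])
  have tr: "curvature M D (SOME Z. vector_field M Z \<and> Z p = b) X Y p = (\<Sum>i\<in>UNIV. \<theta> i p b *\<^sub>R ?R i)"
    if b: "b \<in> B" for b
  proof -
    \<comment> \<open>Freezing the coefficients at \<open>p\<close> gives a field through
      \<open>b\<close>. Its existence guarantees that the choice in \<open>ricci\<close> does return
      an extension of \<open>b\<close>.\<close>
    let ?Z = "\<lambda>q. \<Sum>i\<in>UNIV. \<theta> i p b *\<^sub>R E i q"
    have "vector_field M ?Z \<and> ?Z p = b"
      using frame_expansion[OF p] b B(1) by (auto intro!: vector_field_sum vector_field_scaleR frame)
    then have "vector_field M (SOME Z. vector_field M Z \<and> Z p = b) \<and> (SOME Z. vector_field M Z \<and> Z p = b) p = b"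
      by (rule someI[of "\<lambda>Z. vector_field M Z \<and> Z p = b"])
    then show ?thesis using curvature_frame[OF _ X Y p, of "SOME Z. vector_field M Z \<and> Z p = b"] by simp
  qed
  have "ricci M D X Y p = (\<Sum>b\<in>B. curvature M D (SOME Z. vector_field M Z \<and> Z p = b) X Y p \<bullet> b)"
    by (simp add: ricci_def trace_on_def Let_def B_def)
  also have "\<dots> = (\<Sum>b\<in>B. \<Sum>i\<in>UNIV. (?R i \<bullet> b) * \<theta> i p b)"
    by (simp add: tr inner_sum_left mult.commute)
  also have "\<dots> = (\<Sum>i\<in>UNIV. \<Sum>b\<in>B. (?R i \<bullet> b) * \<theta> i p b)"
    by (rule sum.swap)
  also have "\<dots> = (\<Sum>i\<in>UNIV. \<Sum>b\<in>B. \<theta> i p ((?R i \<bullet> b) *\<^sub>R b))"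
    using B(1) by (intro sum.cong) (auto simp: coframe_scaleR[OF p])
  also have "\<dots> = (\<Sum>i\<in>UNIV. \<theta> i p (\<Sum>b\<in>B. (?R i \<bullet> b) *\<^sub>R b))"
    using B(1) by (intro sum.cong refl coframe_sum[OF p, symmetric] subspace_scale[OF subspace_tangent[OF p]]) auto
  finally show ?thesis using expand[OF R] by simp
qed

text \<open>Metric compatibility is written out for the three derivatives and added with signs
  \<open>+\<close>, \<open>+\<close>, \<open>-\<close>; vanishing torsion turns differences of
  covariant derivatives into brackets. Symmetry and additivity of \<open>g\<close> are assumed
  because \<open>levi_civita\<close> does not contain them.\<close>

lemma koszul:
  assumes X: "vector_field M X" and Y: "vector_field M Y" and Z: "vector_field M Z" and p: "p \<in> M"
    and sym: "\<And>v w. g p v w = g p w v"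
    and diff: "\<And>u v w. \<lbrakk>u \<in> tangent_space M p; v \<in> tangent_space M p; w \<in> tangent_space M p\<rbrakk>
      \<Longrightarrow> g p (u - v) w = g p u w - g p v w"
  shows "2 * g p (D X Y p) (Z p) =
      differential M (\<lambda>q. g q (Y q) (Z q)) p (X p) + differential M (\<lambda>q. g q (X q) (Z q)) p (Y p)
      - differential M (\<lambda>q. g q (X q) (Y q)) p (Z p)
      + g p (lie_bracket M X Y p) (Z p) - g p (lie_bracket M X Z p) (Y p) - g p (lie_bracket M Y Z p) (X p)"
proof -
  have t: "A p \<in> tangent_space M p" if "vector_field M A" for A
    using that p unfolding vector_field_def by blast
  have br: "g p (lie_bracket M A B p) (C p) = g p (D A B p) (C p) - g p (D B A p) (C p)"
    if "vector_field M A" "vector_field M B" "vector_field M C" for A B C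
    using that D_torsion[OF that(1,2) p] diff t D_field by simp
  show ?thesis
    unfolding br[OF X Y Z] br[OF X Z Y] br[OF Y Z X] D_metric[OF X Y Z p] D_metric[OF Y X Z p] D_metric[OF Z X Y p]
    using sym[of "Y p"] sym[of "X p"] by simp
qed

end

section \<open>Frames on the 3-sphere and on the product with an interval\<close>

lemma tangent_space_sphere:
  fixes p :: "'a::euclidean_space"
  assumes "p \<in> sphere 0 1"
  shows "tangent_space (sphere 0 1) p = {v. v \<bullet> p = 0}"
proof (intro set_eqI iffI; clarify)
  fix v assume "v \<in> tangent_space (sphere 0 1) p"
  then obtain \<gamma> :: "real \<Rightarrow> 'a" where \<gamma>: "\<gamma> 0 = p" "\<forall>\<^sub>F s in at 0. \<gamma> s \<in> sphere 0 1"
      "(\<gamma> has_vector_derivative v) (at 0)"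
    unfolding tangent_space_def by auto
  \<comment> \<open>The squared norm is constant on the sphere, so this derivative must vanish on
    velocities of curves in the sphere.\<close>
  have *: "((\<lambda>q. q \<bullet> q) has_derivative (\<lambda>w. p \<bullet> w + w \<bullet> p)) (at p within sphere 0 1)"
    by (auto intro!: derivative_eq_intros)
  have "((\<lambda>q. 1::real) has_derivative (\<lambda>w. p \<bullet> w + w \<bullet> p)) (at p within sphere 0 1)"
    by (rule has_derivative_transform[OF assms _ *]) (simp add: dot_square_norm)
  from has_derivative_along_curve[OF this assms \<gamma>]
  have "((\<lambda>s. 1::real) has_vector_derivative p \<bullet> v + v \<bullet> p) (at (0::real))" .
  then have "p \<bullet> v + v \<bullet> p = 0"
    using has_vector_derivative_const vector_derivative_unique_at by blast
  then show "v \<bullet> p = 0" by (simp add: inner_commute)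
next
  have pp: "p \<bullet> p = 1" using assms by (simp add: dot_square_norm)
  fix v assume v: "v \<bullet> p = 0"
  \<comment> \<open>The line \<open>p + s *\<^sub>R v\<close> projected radially to the sphere; by
    orthogonality its norm is the square root in the denominator.\<close>
  define \<gamma> where "\<gamma> = (\<lambda>s::real. (1 / sqrt (1 + s\<^sup>2 * (v \<bullet> v))) *\<^sub>R (p + s *\<^sub>R v))"
  have \<gamma>0: "\<gamma> 0 = p" by (simp add: \<gamma>_def)
  have pos: "1 + s\<^sup>2 * (v \<bullet> v) > 0" for s :: real
    by (simp add: add_pos_nonneg)
  have "norm (\<gamma> s) = 1" for s
  proof -
    have "norm (p + s *\<^sub>R v) = sqrt (1 + s\<^sup>2 * (v \<bullet> v))"
      using v pp by (simp add: norm_eq_sqrt_inner algebra_simps inner_commute power2_eq_square)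
    moreover have "sqrt (1 + s\<^sup>2 * (v \<bullet> v)) > 0" using pos by simp
    ultimately show ?thesis by (simp add: \<gamma>_def)
  qed
  then have "\<forall>\<^sub>F s in at 0. \<gamma> s \<in> sphere 0 1" by simp
  moreover have "(\<gamma> has_vector_derivative v) (at 0)"
    unfolding \<gamma>_def by (auto intro!: derivative_eq_intros)
  ultimately show "v \<in> tangent_space (sphere 0 1) p"
    unfolding tangent_space_def by (intro CollectI exI[of _ \<gamma>]) (auto simp: \<gamma>0)
qed

lemma tangent_space_Times:
  fixes I :: "real set" and N :: "'a::euclidean_space set"
  assumes "open I" "t \<in> I"
  shows "tangent_space (I \<times> N) (t, p) = UNIV \<times> tangent_space N p"
proof (intro set_eqI iffI)
  fix w assume "w \<in> tangent_space (I \<times> N) (t, p)"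
  then obtain \<gamma> :: "real \<Rightarrow> real \<times> 'a" where \<gamma>: "\<gamma> 0 = (t, p)" "\<forall>\<^sub>F s in at 0. \<gamma> s \<in> I \<times> N"
      "(\<gamma> has_vector_derivative w) (at 0)"
    unfolding tangent_space_def by auto
  have "((\<lambda>s. snd (\<gamma> s)) has_vector_derivative snd w) (at 0)"
    by (rule bounded_linear.has_vector_derivative[OF bounded_linear_snd \<gamma>(3)])
  moreover have "\<forall>\<^sub>F s in at 0. snd (\<gamma> s) \<in> N"
    using \<gamma>(2) by eventually_elim auto
  ultimately have "snd w \<in> tangent_space N p"
    using \<gamma>(1) unfolding tangent_space_def by (auto intro!: exI[of _ "\<lambda>s. snd (\<gamma> s)"])
  then show "w \<in> UNIV \<times> tangent_space N p" by (cases w) auto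
next
  fix w :: "real \<times> 'a" assume "w \<in> UNIV \<times> tangent_space N p"
  then obtain \<gamma> where \<gamma>: "\<gamma> 0 = p" "\<forall>\<^sub>F s in at 0. \<gamma> s \<in> N" "(\<gamma> has_vector_derivative snd w) (at (0::real))"
    unfolding tangent_space_def by auto
  have "((\<lambda>s::real. t + s * fst w) \<longlongrightarrow> t + 0 * fst w) (at 0)" by (intro tendsto_intros)
  then have "\<forall>\<^sub>F s in at 0. t + s * fst w \<in> I"
    using assms topological_tendstoD[of _ "t + 0 * fst w" "at 0" I] by simp
  then have "\<forall>\<^sub>F s in at 0. (t + s * fst w, \<gamma> s) \<in> I \<times> N"
    using \<gamma>(2) by eventually_elim auto
  moreover have "((\<lambda>s. (t + s * fst w, \<gamma> s)) has_vector_derivative (fst w, snd w)) (at 0)"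
    by (intro has_vector_derivative_Pair \<gamma>(3)) (auto intro!: derivative_eq_intros)
  ultimately show "w \<in> tangent_space (I \<times> N) (t, p)"
    using \<gamma>(1) unfolding tangent_space_def by (auto intro!: exI[of _ "\<lambda>s. (t + s * fst w, \<gamma> s)"])
qed

section \<open>An auxiliary global frame on the sphere\<close>

lemma three_cases: obtains "i = (1::3)" | "i = 2" | "i = 3"
  using exhaust_3 by blast

text \<open>Left multiplication of the quaternion \<open>p\<close> by the three imaginary units.\<close>

definition quaternion_frame :: "3 \<Rightarrow> real^4 \<Rightarrow> real^4" where
  "quaternion_frame i p =
    (if i = 1 then vector [- p$2, p$1, - p$4, p$3]
     else if i = 2 then vector [- p$3, p$4, p$1, - p$2]
     else vector [- p$4, - p$3, p$2, p$1])"

lemma linear_quaternion_frame: "bounded_linear (quaternion_frame i)"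
  unfolding linear_conv_bounded_linear[symmetric]
  by (rule linearI) (auto simp: quaternion_frame_def vector_def vec_eq_iff forall_4 algebra_simps)

lemma quaternion_frame_tangent: "p \<in> S3 \<Longrightarrow> quaternion_frame i p \<in> tangent_space S3 p"
  by (auto simp: tangent_space_sphere quaternion_frame_def vector_def inner_vec_def sum_4)

lemma vector_field_quaternion_frame: "vector_field S3 (quaternion_frame i)"
  unfolding vector_field_def
  using smooth_map_linear[OF linear_quaternion_frame] quaternion_frame_tangent by blast

text \<open>The three fields form an orthonormal basis of the orthogonal complement of
  \<open>p\<close>. Each coordinate of the claim is a polynomial consequence of
  \<open>p \<bullet> p = 1\<close> and \<open>v \<bullet> p = 0\<close>.\<close>

lemma quaternion_frame_expansion:
  assumes "p \<in> S3" "v \<in> tangent_space S3 p"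
  shows "(\<Sum>j\<in>UNIV. (v \<bullet> quaternion_frame j p) *\<^sub>R quaternion_frame j p) = v"
proof -
  have p: "p$1 * p$1 + p$2 * p$2 + p$3 * p$3 + p$4 * p$4 = 1"
    using assms(1) by (simp add: norm_eq_sqrt_inner inner_vec_def sum_4)
  have v: "v$1 * p$1 + v$2 * p$2 + v$3 * p$3 + v$4 * p$4 = 0"
    using assms by (simp add: tangent_space_sphere inner_vec_def sum_4)
  show ?thesis
    unfolding vec_eq_iff forall_4
    using p v by (simp add: quaternion_frame_def vector_def inner_vec_def sum_4 sum_3) algebra
qed

lemma smooth_map_det_3:
  fixes A :: "'a::euclidean_space \<Rightarrow> real^3^3"
  assumes "\<And>k j. smooth_map M (\<lambda>p. A p $ k $ j)"
  shows "smooth_map M (\<lambda>p. det (A p))"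
  unfolding det_3 by (intro smooth_intros assms)

section \<open>The frame dual to the given coframe\<close>

locale S3_frame =
  fixes e :: "3 \<Rightarrow> real^4 \<Rightarrow> real^4 \<Rightarrow> real"
  assumes coframe: "S3_coframe e"
begin

lemma e_linear:
  "\<lbrakk>p \<in> S3; v \<in> tangent_space S3 p; w \<in> tangent_space S3 p\<rbrakk>
    \<Longrightarrow> e i p (a *\<^sub>R v + b *\<^sub>R w) = a * e i p v + b * e i p w"
  and e_smooth: "vector_field S3 X \<Longrightarrow> smooth_map S3 (\<lambda>p. e i p (X p))"
  and e_bij: "p \<in> S3 \<Longrightarrow> bij_betw (\<lambda>v i. e i p v) (tangent_space S3 p) UNIV"
  and e_structure: "\<lbrakk>vector_field S3 X; vector_field S3 Y; p \<in> S3\<rbrakk>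
    \<Longrightarrow> exterior_derivative S3 (e i) X Y p = 2 * wedge (e (i + 1)) (e (i + 2)) X Y p"
  using coframe unfolding S3_coframe_def one_form_def by blast+

lemma subspace_S3: "p \<in> S3 \<Longrightarrow> subspace (tangent_space S3 p)"
  by (auto simp: tangent_space_sphere subspace_def inner_left_distrib)

lemma e_sum:
  assumes p: "p \<in> S3" and "\<And>j. j \<in> S \<Longrightarrow> v j \<in> tangent_space S3 p"
  shows "e i p (\<Sum>j\<in>S. c j *\<^sub>R v j) = (\<Sum>j\<in>S. c j * e i p (v j))"
  using assms(2)
proof (induction S rule: infinite_finite_induct)
  case (insert j S)
  have "e i p (c j *\<^sub>R v j + 1 *\<^sub>R (\<Sum>j\<in>S. c j *\<^sub>R v j)) = c j * e i p (v j) + 1 * e i p (\<Sum>j\<in>S. c j *\<^sub>R v j)"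
    using insert by (intro e_linear p subspace_sum[OF subspace_S3] subspace_scale[OF subspace_S3]) auto
  then show ?case using insert by simp
qed (use e_linear[OF p, of 0 0 i 0 0] subspace_0[OF subspace_S3[OF p]] in auto)

text \<open>The numbers \<open>e i p (quaternion_frame j p)\<close> are smooth in \<open>p\<close>
  by \<open>e_smooth\<close>, so every evaluation of \<open>e i\<close> is reduced to smooth
  coefficients.\<close>

lemma e_expansion:
  assumes "p \<in> S3" "v \<in> tangent_space S3 p"
  shows "e i p v = (\<Sum>j\<in>UNIV. (v \<bullet> quaternion_frame j p) * e i p (quaternion_frame j p))"
  using e_sum[OF assms(1), of UNIV "\<lambda>j. quaternion_frame j p" i "\<lambda>j. v \<bullet> quaternion_frame j p"]
    quaternion_frame_expansion[OF assms] quaternion_frame_tangent[OF assms(1)] by simp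

text \<open>The preimages of the unit vectors under the coframe bijection. This is a pointwise
  definition; smoothness is supplied by \<open>vector_field_Z\<close>.\<close>

definition Z :: "3 \<Rightarrow> real^4 \<Rightarrow> real^4" where
  "Z i p = inv_into (tangent_space S3 p) (\<lambda>v i. e i p v) (\<lambda>k. if k = i then 1 else 0)"

lemma Z_tangent: "p \<in> S3 \<Longrightarrow> Z i p \<in> tangent_space S3 p"
  unfolding Z_def using e_bij by (metis UNIV_I bij_betw_imp_surj_on inv_into_into)

lemma e_Z: "p \<in> S3 \<Longrightarrow> e k p (Z i p) = (if k = i then 1 else 0)"
  unfolding Z_def using bij_betw_inv_into_right[OF e_bij, of p "\<lambda>k. if k = i then 1 else 0"]
  by (simp add: fun_eq_iff)

lemma Z_expansion:
  assumes p: "p \<in> S3" and v: "v \<in> tangent_space S3 p"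
  shows "(\<Sum>i\<in>UNIV. e i p v *\<^sub>R Z i p) = v"
proof -
  have "(\<lambda>k. e k p (\<Sum>i\<in>UNIV. e i p v *\<^sub>R Z i p)) = (\<lambda>k. e k p v)"
    using e_sum[OF p, of UNIV "\<lambda>i. Z i p"] Z_tangent[OF p] by (simp add: e_Z[OF p] if_distrib cong: if_cong)
  moreover have "(\<Sum>i\<in>UNIV. e i p v *\<^sub>R Z i p) \<in> tangent_space S3 p"
    using Z_tangent[OF p] by (intro subspace_sum[OF subspace_S3[OF p]] subspace_scale[OF subspace_S3[OF p]])
  ultimately show ?thesis
    using bij_betw_imp_inj_on[OF e_bij[OF p]] v by (auto dest!: inj_onD)
qed

text \<open>The coefficients of \<open>Z i\<close> in the quaternion frame solve a linear system
  whose matrix \<open>A\<close> has smooth entries. Cramer's rule exhibits them as quotients of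
  smooth determinants.\<close>

lemma vector_field_Z: "vector_field S3 (Z i)"
proof -
  define A where "A = (\<lambda>p. \<chi> k j. e k p (quaternion_frame j p))"
  \<comment> \<open>\<open>A' j\<close> is \<open>A\<close> with column \<open>j\<close> replaced by
    the right-hand side of the system, the unit vector of index \<open>i\<close>.\<close>
  define A' where "A' = (\<lambda>j p. \<chi> k l. if l = j then if k = i then 1 else 0 else A p $ k $ l)"
  have smA: "smooth_map S3 (\<lambda>p. A p $ k $ j)" for k j
    by (simp add: A_def e_smooth vector_field_quaternion_frame)
  have smA': "smooth_map S3 (\<lambda>p. A' m p $ k $ j)" for m k j
    by (cases "j = m") (simp_all add: A'_def smA)
  have det: "det (A p) \<noteq> 0" if p: "p \<in> S3" for p
  proof -
    \<comment> \<open>The coefficients of all \<open>Z l\<close> form a right inverse of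
      \<open>A p\<close>, so the determinant cannot vanish.\<close>
    have "A p ** (\<chi> j l. Z l p \<bullet> quaternion_frame j p) = mat 1"
      using e_expansion[OF p Z_tangent[OF p]] e_Z[OF p]
      by (simp add: A_def vec_eq_iff matrix_matrix_mult_def mat_def mult.commute)
    then have "det (A p) * det (\<chi> j l. Z l p \<bullet> quaternion_frame j p) = 1"
      using det_mul det_I by metis
    then show ?thesis by auto
  qed
  have coeff: "Z i p \<bullet> quaternion_frame j p = det (A' j p) / det (A p)" if p: "p \<in> S3" for p j
  proof -
    let ?x = "\<chi> j. Z i p \<bullet> quaternion_frame j p"
    have "(A p *v ?x) $ k = (if k = i then 1 else 0)" for k
      using e_expansion[OF p Z_tangent[OF p], of k i] e_Z[OF p]
      by (simp add: A_def matrix_vector_mult_def mult.commute)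
    then have "det (A' j p) = ?x $ j * det (A p)"
      using cramer_lemma[of j "A p" ?x] by (simp add: A'_def cong: if_cong)
    then show ?thesis using det[OF p] by simp
  qed
  have "smooth_map S3 (\<lambda>p. \<Sum>j\<in>UNIV. (det (A' j p) / det (A p)) *\<^sub>R quaternion_frame j p)"
    by (intro smooth_map_sum smooth_map_scaleR smooth_map_divide smooth_map_det_3 smA smA'
        smooth_map_linear[OF linear_quaternion_frame] det)
  then have "smooth_map S3 (Z i)"
  proof (rule smooth_map_cong)
    fix p assume p: "p \<in> S3"
    show "(\<Sum>j\<in>UNIV. (det (A' j p) / det (A p)) *\<^sub>R quaternion_frame j p) = Z i p"
      using quaternion_frame_expansion[OF p Z_tangent[OF p, of i]] by (simp add: coeff[OF p])
  qed
  then show ?thesis using Z_tangent unfolding vector_field_def by blast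
qed

text \<open>The functions \<open>e k (Z j)\<close> are constant on the sphere, so both derivative
  terms of the exterior derivative drop out and the structure equation determines the bracket:
  \<open>[Z (k + 1), Z (k + 2)] = - 2 Z k\<close>.\<close>

lemma e_bracket:
  assumes p: "p \<in> S3"
  shows "e k p (lie_bracket S3 (Z i) (Z j) p) =
    - 2 * ((if k + 1 = i \<and> k + 2 = j then 1 else 0) - (if k + 1 = j \<and> k + 2 = i then 1 else 0))"
proof -
  have "differential S3 (\<lambda>q. e k q (Z l q)) p (Z m p) = 0" for l m
    by (rule differential_const[OF p e_Z Z_tangent[OF p]])
  then have "exterior_derivative S3 (e k) (Z i) (Z j) p = - e k p (lie_bracket S3 (Z i) (Z j) p)"
    by (simp add: exterior_derivative_def)
  then have *: "e k p (lie_bracket S3 (Z i) (Z j) p) = - 2 * wedge (e (k + 1)) (e (k + 2)) (Z i) (Z j) p"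
    using e_structure[OF vector_field_Z[of i] vector_field_Z[of j] p, of k] by linarith
  have "(if P then 1 else 0) * (if Q then 1 else 0) = (if P \<and> Q then 1 else 0 :: real)" for P Q
    by simp
  then show ?thesis
    unfolding * wedge_def e_Z[OF p] by presburger
qed

end

section \<open>The product frame and its brackets\<close>

locale interval_S3 = S3_frame e for e +
  fixes I :: "real set"
  assumes open_I: "open I"
begin

abbreviation M where "M \<equiv> I \<times> S3"

definition E :: "3 option \<Rightarrow> real \<times> (real^4) \<Rightarrow> real \<times> (real^4)" where
  "E a q = (case a of None \<Rightarrow> (1, 0) | Some i \<Rightarrow> (0, Z i (snd q)))"

definition \<theta> :: "3 option \<Rightarrow> real \<times> (real^4) \<Rightarrow> real \<times> (real^4) \<Rightarrow> real" where
  "\<theta> a q w = (case a of None \<Rightarrow> fst w | Some i \<Rightarrow> e i (snd q) (snd w))"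

lemma tangent_M: "q \<in> M \<Longrightarrow> tangent_space M q = UNIV \<times> tangent_space S3 (snd q)"
  using tangent_space_Times[OF open_I] by (cases q) auto

lemma smooth_snd: "smooth_map S3 f \<Longrightarrow> smooth_map M (\<lambda>q. f (snd q))"
  by (rule smooth_map_linear_right[OF bounded_linear_snd]) auto

lemma smooth_fst: "smooth_map I f \<Longrightarrow> smooth_map M (\<lambda>q. f (fst q))"
  by (rule smooth_map_linear_right[OF bounded_linear_fst]) auto

lemma sum_option: "(\<Sum>a\<in>UNIV. f a) = f None + (\<Sum>i\<in>UNIV. f (Some i))" for f :: "3 option \<Rightarrow> 'b::comm_monoid_add"
  by (simp add: UNIV_option_conv sum.reindex)

lemma smooth_Pair0: "smooth_map N f \<Longrightarrow> smooth_map N (\<lambda>q. (0::real, f q))"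
  by (rule smooth_map_linear_left[of "\<lambda>x. (0, x)"])
    (auto intro: bounded_linear_Pair bounded_linear_zero bounded_linear_ident)

sublocale framed M E \<theta>
proof
  fix q assume q: "q \<in> M"
  then have p: "snd q \<in> S3" by auto
  show "subspace (tangent_space M q)"
    unfolding tangent_M[OF q] using subspace_S3[OF p] by (auto simp: subspace_def zero_prod_def)
  show "\<theta> i q (E j q) = (if i = j then 1 else 0)" for i j
    using e_linear[OF p, of 0 0 _ 0 0] subspace_0[OF subspace_S3[OF p]]
    by (auto simp: \<theta>_def E_def e_Z[OF p] split: option.splits)
  fix v assume v: "v \<in> tangent_space M q"
  show "(\<Sum>i\<in>UNIV. \<theta> i q v *\<^sub>R E i q) = v"
    using v Z_expansion[OF p, of "snd v"] unfolding tangent_M[OF q]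
    by (auto simp: sum_option \<theta>_def E_def prod_eq_iff fst_sum snd_sum)
  fix w a b i assume w: "w \<in> tangent_space M q"
  show "\<theta> i q (a *\<^sub>R v + b *\<^sub>R w) = a * \<theta> i q v + b * \<theta> i q w"
    using v w unfolding tangent_M[OF q] by (auto simp: \<theta>_def e_linear[OF p] split: option.splits)
next
  fix i
  have "smooth_map M (E i)"
    using smooth_Pair0[OF smooth_snd[of "Z (the i)"]] vector_field_Z
    unfolding E_def vector_field_def by (cases i) auto
  moreover have "E i q \<in> tangent_space M q" if "q \<in> M" for q
  proof -
    have "snd q \<in> S3" using that by auto
    then show ?thesis
      using Z_tangent subspace_0[OF subspace_S3] unfolding tangent_M[OF that] E_def by (auto split: option.splits)
  qed
  ultimately show "vector_field M (E i)" by (simp add: vector_field_def)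
next
  fix X i assume X: "vector_field M X"
  have fstX: "smooth_map M (\<lambda>q. fst (X q))" and sndX: "smooth_map M (\<lambda>q. snd (X q))"
    using X smooth_map_linear_left bounded_linear_fst bounded_linear_snd
    unfolding vector_field_def by blast+
  show "smooth_map M (\<lambda>q. \<theta> i q (X q))"
  proof (cases i)
    case None
    then show ?thesis using fstX by (simp add: \<theta>_def)
  next
    case (Some k)
    \<comment> \<open>The spherical part of \<open>X\<close> may also depend on \<open>t\<close>, so
      it need not be a vector field on \<open>S3\<close> and \<open>e_smooth\<close> does not apply
      to it. The quaternion frame separates the two dependences.\<close>
    have "smooth_map M (\<lambda>q. \<Sum>j\<in>UNIV. (snd (X q) \<bullet> quaternion_frame j (snd q)) * e k (snd q) (quaternion_frame j (snd q)))"
      by (intro smooth_intros sndX smooth_snd smooth_map_linear linear_quaternion_frame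
          e_smooth[OF vector_field_quaternion_frame])
    then show ?thesis
    proof (rule smooth_map_cong)
      fix q assume q: "q \<in> M"
      then have "X q \<in> tangent_space M q" using X unfolding vector_field_def by blast
      then have "snd (X q) \<in> tangent_space S3 (snd q)"
        unfolding tangent_M[OF q] by auto
      then show "(\<Sum>j\<in>UNIV. (snd (X q) \<bullet> quaternion_frame j (snd q)) * e k (snd q) (quaternion_frame j (snd q))) = \<theta> i q (X q)"
        using e_expansion[of "snd q" "snd (X q)" k] q by (auto simp: \<theta>_def Some)
    qed
  qed
qed

lemma differential_fst:
  assumes "smooth_map I f" "q \<in> M" "w \<in> tangent_space M q"
  shows "differential M (\<lambda>q. f (fst q)) q w = fst w *\<^sub>R vector_derivative f (at (fst q))"
proof -
  have t: "fst q \<in> I" using assms(2) by auto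
  then have "at (fst q) within I = at (fst q)" using open_I at_within_open by blast
  then have "f differentiable (at (fst q))"
    using smooth_map_has_derivative[OF assms(1) t] by (auto simp: differentiable_def)
  then have "(f has_derivative (\<lambda>x. x *\<^sub>R vector_derivative f (at (fst q)))) (at (fst q))"
    by (simp add: vector_derivative_works has_vector_derivative_def)
  then have "((\<lambda>q. f (fst q)) has_derivative (\<lambda>w. fst w *\<^sub>R vector_derivative f (at (fst q)))) (at q within M)"
    by (rule has_derivative_compose[OF bounded_linear_imp_has_derivative[OF bounded_linear_fst]])
  then show ?thesis by (rule differential_eq) (use assms in auto)
qed

lemma differential_E:
  assumes "q \<in> M" "w \<in> tangent_space M q"
  shows "differential M (E (Some i)) q w = (0, differential S3 (Z i) (snd q) (snd w))"
    and "differential M (E None) q w = 0"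
proof -
  have p: "snd q \<in> S3" using assms(1) by auto
  have "(Z i has_derivative differential S3 (Z i) (snd q)) (at (snd q) within snd ` M)"
    using smooth_map_has_derivative[OF _ p, of "Z i"] vector_field_Z has_derivative_subset[of _ _ _ S3 "snd ` M"]
    unfolding vector_field_def by auto
  then have "((\<lambda>q. Z i (snd q)) has_derivative (\<lambda>w. differential S3 (Z i) (snd q) (snd w))) (at q within M)"
    by (intro has_derivative_in_compose[OF bounded_linear_imp_has_derivative[OF bounded_linear_snd]])
  then have "((\<lambda>q. (0::real, Z i (snd q))) has_derivative (\<lambda>w. (0, differential S3 (Z i) (snd q) (snd w)))) (at q within M)"
    by (intro has_derivative_Pair has_derivative_const)
  then show "differential M (E (Some i)) q w = (0, differential S3 (Z i) (snd q) (snd w))"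
    using differential_eq[of "\<lambda>q. (0::real, Z i (snd q))", OF _ assms] by (simp add: E_def[abs_def])
  show "differential M (E None) q w = 0"
    by (rule differential_const[OF assms(1) _ assms(2), of _ "(1, 0)"]) (simp add: E_def)
qed

text \<open>The coefficient of \<open>E c\<close> in the bracket of \<open>E a\<close> and
  \<open>E b\<close>. Brackets with the radial field vanish because the lifted fields do not depend
  on \<open>t\<close>.\<close>

definition structure_constant :: "3 option \<Rightarrow> 3 option \<Rightarrow> 3 option \<Rightarrow> real" where
  "structure_constant c a b = (case (c, a, b) of
      (Some k, Some i, Some j) \<Rightarrow>
        - 2 * ((if k + 1 = i \<and> k + 2 = j then 1 else 0) - (if k + 1 = j \<and> k + 2 = i then 1 else 0))
    | _ \<Rightarrow> 0)"

lemma coframe_bracket: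
  assumes q: "q \<in> M"
  shows "\<theta> c q (lie_bracket M (E a) (E b) q) = structure_constant c a b"
proof -
  have p: "snd q \<in> S3" using q by auto
  have lin0: "differential S3 (Z i) (snd q) 0 = 0" for i
    using smooth_map_has_derivative[OF _ p, of "Z i"] vector_field_Z has_derivative_linear linear_0
    unfolding vector_field_def by blast
  have e0: "e k (snd q) 0 = 0" for k
    using e_linear[OF p, of 0 0 k 0 0] subspace_0[OF subspace_S3[OF p]] by simp
  note [simp] = differential_E[OF q frame_tangent[OF q]]
  have N: "lie_bracket M (E None) (E b) q = 0" "lie_bracket M (E b) (E None) q = 0" for b
    by (cases b; simp add: lie_bracket_def; simp add: E_def lin0 zero_prod_def)+
  have S: "lie_bracket M (E (Some i)) (E (Some j)) q = (0, lie_bracket S3 (Z i) (Z j) (snd q))" for i j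
    by (simp add: lie_bracket_def; simp add: E_def)
  show ?thesis
    by (cases c; cases a; cases b)
      (simp_all only: N S structure_constant_def \<theta>_def e0 e_bracket[OF p] option.case prod.case fst_conv snd_conv
        fst_zero snd_zero)
qed

end

section \<open>The Ricci curvature of a diagonal metric\<close>

text \<open>Arithmetic modulo 3 that lets later formulas be stated for \<open>i\<close>,
  \<open>i + 1\<close>, \<open>i + 2\<close> with \<open>i\<close> arbitrary.\<close>

lemma cyclic_3 [simp]:
  fixes i :: 3
  shows "i + 1 \<noteq> i" "i + 2 \<noteq> i" "i + 2 \<noteq> i + 1" "i \<noteq> i + 1" "i \<noteq> i + 2" "i + 1 \<noteq> i + 2"
    "i + 1 + 1 = i + 2" "i + 1 + 2 = i" "i + 2 + 1 = i" "i + 2 + 2 = i + 1"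
  by (cases i rule: three_cases; simp)+

lemma three_cyclic_cases: obtains "k = i" | "k = i + 1" | "k = i + (2::3)"
  by (cases i rule: three_cases; cases k rule: three_cases; simp)

lemma sum_3_cyclic: "(\<Sum>j\<in>UNIV. f j) = f i + f (i + 1) + f (i + (2::3))" for f :: "3 \<Rightarrow> 'b::comm_monoid_add"
proof -
  \<comment> \<open>The case distinction on \<open>i\<close> leaves the index numerals 4 and 5,
    which denote 1 and 2 modulo 3.\<close>
  have "(4::3) = 1" "(5::3) = 2" by simp_all
  then have "f 4 = f 1" "f 5 = f 2" by metis+
  then show ?thesis
    by (cases i rule: three_cases) (simp_all add: sum_3 ac_simps)
qed

lemma smooth_map_deriv:
  fixes f :: "real \<Rightarrow> real"
  assumes "open I" "smooth_map I f"
  shows "t \<in> I \<Longrightarrow> (f has_real_derivative deriv f t) (at t)" and "smooth_map I (deriv f)"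
proof -
  show *: "(f has_real_derivative deriv f t) (at t)" if "t \<in> I" for t
  proof -
    have "(f has_derivative differential I f t) (at t)"
      using smooth_map_has_derivative[OF assms(2) that] at_within_open[OF that assms(1)] by simp
    then have "f differentiable (at t)" by (rule differentiableI)
    then show ?thesis
      by (metis DERIV_imp_deriv real_differentiable_def field_differentiable_def)
  qed
  \<comment> \<open>The unit vector is tangent to an open set of reals, so \<open>deriv f\<close> is
    the differential of \<open>f\<close> on the constant field 1 and
    \<open>smooth_map_differential\<close> applies.\<close>
  have tangent: "1 \<in> tangent_space I t" if "t \<in> I" for t
  proof -
    have "((\<lambda>s. t + s) \<longlongrightarrow> t + 0) (at (0::real))" by (intro tendsto_intros)
    then have "\<forall>\<^sub>F s in at 0. t + s \<in> I"
      using assms(1) that topological_tendstoD[of _ "t + 0" "at 0" I] by simp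
    moreover have "((\<lambda>s. t + s) has_vector_derivative 1) (at (0::real))"
      by (auto intro!: derivative_eq_intros)
    ultimately show ?thesis unfolding tangent_space_def by (auto intro!: exI[of _ "\<lambda>s. t + s"])
  qed
  then have "vector_field I (\<lambda>_. 1)" by (simp add: vector_field_def)
  then have "smooth_map I (\<lambda>t. differential I f t 1)" by (rule smooth_map_differential[OF assms(2)])
  then show "smooth_map I (deriv f)"
  proof (rule smooth_map_cong)
    fix t assume t: "t \<in> I"
    have "(f has_derivative (\<lambda>h. deriv f t * h)) (at t within I)"
      using *[OF t] has_derivative_at_withinI by (simp add: has_field_derivative_def)
    then show "differential I f t 1 = deriv f t"
      using differential_eq t tangent by fastforce
  qed
qed

context interval_S3
begin

lemma differential_fst_real:
  fixes f :: "real \<Rightarrow> real"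
  assumes "smooth_map I f" "q \<in> M" "w \<in> tangent_space M q"
  shows "differential M (\<lambda>q. f (fst q)) q w = fst w * deriv f (fst q)"
proof -
  have "(f has_real_derivative deriv f (fst q)) (at (fst q))"
    using smooth_map_deriv[OF open_I assms(1)] assms(2) by auto
  then have "vector_derivative f (at (fst q)) = deriv f (fst q)"
    by (simp add: has_real_derivative_iff_has_vector_derivative vector_derivative_at)
  then show ?thesis using differential_fst[OF assms] by simp
qed

lemma differential_fst_E:
  fixes f :: "real \<Rightarrow> real"
  assumes "smooth_map I f" "q \<in> M"
  shows "differential M (\<lambda>q. f (fst q)) q (E c q) = (if c = None then deriv f (fst q) else 0)"
  using differential_fst_real[OF assms frame_tangent[OF assms(2)]]
  by (auto simp: E_def split: option.splits)

end

locale diagonal_metric = interval_S3 e I for e I +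
  fixes A :: "3 \<Rightarrow> real \<Rightarrow> real" and g D
  assumes A_smooth: "smooth_map I (A i)"
    and A_pos: "t \<in> I \<Longrightarrow> A i t > 0"
    and g_eq: "g = (\<lambda>(t, p) (\<tau>, v) (\<sigma>, w). \<tau> * \<sigma> + (\<Sum>i\<in>UNIV. (A i t)\<^sup>2 * (e i p v * e i p w)))"
    and levi_civita: "levi_civita (I \<times> S3) g D"
begin

sublocale framed_connection "I \<times> S3" E \<theta> g D
  by standard (rule levi_civita)

text \<open>The squared lengths of the frame fields, which are orthogonal for
  \<open>g\<close>.\<close>

definition h :: "3 option \<Rightarrow> real \<Rightarrow> real" where
  "h c t = (case c of None \<Rightarrow> 1 | Some i \<Rightarrow> (A i t)\<^sup>2)"

lemma A_nonzero: "t \<in> I \<Longrightarrow> A i t \<noteq> 0"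
  using A_pos[of t i] by simp

lemma h_smooth: "smooth_map I (h c)"
  unfolding h_def by (cases c) (auto intro: smooth_map_power A_smooth)

lemma h_pos: "t \<in> I \<Longrightarrow> h c t > 0"
  unfolding h_def using A_pos[of t] by (auto split: option.split simp: less_imp_neq[symmetric])

lemma g_h: "g q v w = (\<Sum>c\<in>UNIV. h c (fst q) * (\<theta> c q v * \<theta> c q w))"
  unfolding g_eq by (cases q; cases v; cases w) (simp add: sum_option h_def \<theta>_def)

lemma g_frame:
  assumes "q \<in> M"
  shows "g q v (E c q) = h c (fst q) * \<theta> c q v"
proof -
  have "g q v (E c q) = (\<Sum>d\<in>UNIV. if d = c then h d (fst q) * \<theta> d q v else 0)"
    unfolding g_h by (intro sum.cong) (auto simp: coframe_frame[OF assms])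
  then show ?thesis by simp
qed

text \<open>The Koszul formula for an orthogonal frame, solved for the coefficient of
  \<open>E c\<close> in \<open>D (E a) (E b)\<close>. The squared lengths depend on \<open>t\<close>
  only, so derivatives survive only along the radial field.\<close>

definition christoffel :: "3 option \<Rightarrow> 3 option \<Rightarrow> 3 option \<Rightarrow> real \<Rightarrow> real" where
  "christoffel a b c t =
    ((if a = None \<and> b = c then deriv (h b) t else 0) + (if b = None \<and> a = c then deriv (h a) t else 0)
      - (if c = None \<and> a = b then deriv (h a) t else 0)
      + h c t * structure_constant c a b - h b t * structure_constant b a c - h a t * structure_constant a b c)
    / (2 * h c t)"

lemma D_frame:
  assumes q: "q \<in> M"
  shows "D (E a) (E b) q = (\<Sum>c\<in>UNIV. christoffel a b c (fst q) *\<^sub>R E c q)"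
proof -
  have t: "fst q \<in> I" using q by auto
  have sym: "g q v w = g q w v" for v w
    unfolding g_h by (simp add: mult.commute)
  have diff: "g q (u - v) w = g q u w - g q v w"
    if "u \<in> tangent_space M q" "v \<in> tangent_space M q" for u v w
  proof -
    have *: "\<theta> c q (u - v) = \<theta> c q u - \<theta> c q v" for c
      using coframe_linear[OF q that, of c 1 "-1"] by simp
    show ?thesis unfolding g_h * by (simp add: algebra_simps sum_subtractf)
  qed
  have dg: "differential M (\<lambda>q. g q (E a q) (E b q)) q (E c q) =
      (if c = None \<and> a = b then deriv (h a) (fst q) else 0)" for a b c
  proof (cases "a = b")
    case True
    have "differential M (\<lambda>q. g q (E a q) (E b q)) q = differential M (\<lambda>q. h a (fst q)) q"
      by (rule differential_cong[OF q]) (simp add: g_frame coframe_frame True)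
    then show ?thesis using differential_fst_E[OF h_smooth q] True by simp
  next
    case False
    then show ?thesis
      using differential_const[OF q _ frame_tangent[OF q], of "\<lambda>q. g q (E a q) (E b q)" 0]
      by (simp add: g_frame coframe_frame)
  qed
  have *: "\<theta> c q (D (E a) (E b) q) = christoffel a b c (fst q)" for c
  proof -
    have "2 * (h c (fst q) * \<theta> c q (D (E a) (E b) q)) =
      (if a = None \<and> b = c then deriv (h b) (fst q) else 0) + (if b = None \<and> a = c then deriv (h a) (fst q) else 0)
      - (if c = None \<and> a = b then deriv (h a) (fst q) else 0)
      + h c (fst q) * structure_constant c a b - h b (fst q) * structure_constant b a c - h a (fst q) * structure_constant a b c"
      using koszul[OF frame frame frame q sym diff, of a b c]
      unfolding g_frame[OF q] dg coframe_bracket[OF q] .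
    then show ?thesis
      using h_pos[OF t, of c] by (simp add: christoffel_def field_simps)
  qed
  have "D (E a) (E b) q \<in> tangent_space M q"
    using D_field[OF frame frame] q unfolding vector_field_def by blast
  from frame_expansion[OF q this] show ?thesis by (simp add: *)
qed

lemma deriv_h:
  assumes "t \<in> I"
  shows "deriv (h None) t = 0" "deriv (h (Some i)) t = 2 * A i t * deriv (A i) t"
proof -
  have "h None = (\<lambda>_. 1)" "h (Some i) = (\<lambda>t. (A i t)\<^sup>2)" by (auto simp: h_def)
  moreover have "((\<lambda>t. (A i t)\<^sup>2) has_real_derivative 2 * A i t * deriv (A i) t) (at t)"
    using smooth_map_deriv(1)[OF open_I A_smooth assms] by (auto intro!: derivative_eq_intros)
  ultimately show "deriv (h None) t = 0" "deriv (h (Some i)) t = 2 * A i t * deriv (A i) t"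
    by (auto intro: DERIV_imp_deriv)
qed

text \<open>The coefficients of \<open>\<nabla>\<close> along the sphere: the first for \<open>\<nabla>\<^bsub>E i\<^esub> E (i + 1)\<close>, the second for
  \<open>\<nabla>\<^bsub>E (i + 1)\<^esub> E i\<close>, both multiples of \<open>E (i + 2)\<close>.\<close>

definition \<gamma> :: "3 \<Rightarrow> real \<Rightarrow> real" where
  "\<gamma> i t = ((A i t)\<^sup>2 - (A (i + 1) t)\<^sup>2 - (A (i + 2) t)\<^sup>2) / (A (i + 2) t)\<^sup>2"

definition \<gamma>' :: "3 \<Rightarrow> real \<Rightarrow> real" where
  "\<gamma>' i t = ((A i t)\<^sup>2 - (A (i + 1) t)\<^sup>2 + (A (i + 2) t)\<^sup>2) / (A (i + 2) t)\<^sup>2"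

lemma c_smooth: "smooth_map I (\<gamma> i)" "smooth_map I (\<gamma>' i)"
  unfolding \<gamma>_def \<gamma>'_def
  by (intro smooth_intros A_smooth; simp add: A_nonzero)+

lemma structure_constant_cyclic:
  "structure_constant (Some k) (Some i) (Some (i + 1)) = (if k = i + 2 then - 2 else 0)"
  "structure_constant (Some k) (Some (i + 1)) (Some i) = (if k = i + 2 then 2 else 0)"
  "structure_constant (Some k) (Some i) (Some (i + 2)) = (if k = i + 1 then 2 else 0)"
  "structure_constant (Some k) (Some (i + 2)) (Some i) = (if k = i + 1 then - 2 else 0)"
  "structure_constant (Some k) (Some (i + 2)) (Some (i + 1)) = (if k = i then 2 else 0)"
  "structure_constant (Some k) (Some (i + 1)) (Some (i + 2)) = (if k = i then - 2 else 0)"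
  "structure_constant (Some k) (Some i) (Some i) = 0"
  by (cases k i rule: three_cyclic_cases; simp add: structure_constant_def)+

lemma structure_constant_None [simp]:
  "structure_constant None a b = 0" "structure_constant c None b = 0" "structure_constant c a None = 0"
  by (auto simp: structure_constant_def split: option.splits)

lemma D_values:
  assumes q: "q \<in> M"
  shows D_TT: "D (E None) (E None) q = 0"
    and D_Ti: "D (E None) (E (Some i)) q = (deriv (A i) (fst q) / A i (fst q)) *\<^sub>R E (Some i) q"
    and D_iT: "D (E (Some i)) (E None) q = (deriv (A i) (fst q) / A i (fst q)) *\<^sub>R E (Some i) q"
    and D_ii: "D (E (Some i)) (E (Some i)) q = (- (A i (fst q) * deriv (A i) (fst q))) *\<^sub>R E None q"
    and D_plus: "D (E (Some i)) (E (Some (i + 1))) q = \<gamma> i (fst q) *\<^sub>R E (Some (i + 2)) q"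
    and D_minus: "D (E (Some (i + 1))) (E (Some i)) q = \<gamma>' i (fst q) *\<^sub>R E (Some (i + 2)) q"
proof -
  have t: "fst q \<in> I" using q by auto
  have pos: "A i (fst q) > 0" for i using A_pos[OF t] .
  note [simp] = D_frame[OF q] sum_option sum_3_cyclic[of _ i] christoffel_def deriv_h[OF t]
    structure_constant_cyclic less_imp_neq[OF pos, symmetric]
  show "D (E None) (E None) q = 0"
    by simp
  show "D (E None) (E (Some i)) q = (deriv (A i) (fst q) / A i (fst q)) *\<^sub>R E (Some i) q"
    by (simp add: h_def power2_eq_square)
  show "D (E (Some i)) (E None) q = (deriv (A i) (fst q) / A i (fst q)) *\<^sub>R E (Some i) q"
    by (simp add: h_def power2_eq_square)
  show "D (E (Some i)) (E (Some i)) q = (- (A i (fst q) * deriv (A i) (fst q))) *\<^sub>R E None q"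
    by (simp add: h_def)
  show "D (E (Some i)) (E (Some (i + 1))) q = \<gamma> i (fst q) *\<^sub>R E (Some (i + 2)) q"
    by (simp add: h_def \<gamma>_def) (simp add: field_simps)
  show "D (E (Some (i + 1))) (E (Some i)) q = \<gamma>' i (fst q) *\<^sub>R E (Some (i + 2)) q"
    by (simp add: h_def \<gamma>'_def) (simp add: field_simps)
qed

section \<open>Curvature components in the frame\<close>

lemma D_multiple:
  assumes q: "q \<in> M" and f: "smooth_map I f"
    and Y: "vector_field M Y" "\<And>q. q \<in> M \<Longrightarrow> Y q = f (fst q) *\<^sub>R E b q"
  shows "D (E a) Y q = (if a = None then deriv f (fst q) else 0) *\<^sub>R E b q + f (fst q) *\<^sub>R D (E a) (E b) q"
proof -
  have sf: "smooth_map M (\<lambda>q. f (fst q))" by (rule smooth_fst[OF f])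
  have "D (E a) Y q = D (E a) (\<lambda>q. f (fst q) *\<^sub>R E b q) q"
    using Y by (intro D_cong2[symmetric] frame q) auto
  also have "\<dots> = differential M (\<lambda>q. f (fst q)) q (E a q) *\<^sub>R E b q + f (fst q) *\<^sub>R D (E a) (E b) q"
    by (rule D_scaleR2[OF sf frame frame q])
  finally show ?thesis by (simp add: differential_fst_E[OF f q])
qed

text \<open>Every bracket of two frame fields is a constant multiple of a single frame field.
  Commuting fields are the case \<open>s = 0\<close>, with \<open>d\<close> arbitrary.\<close>

lemma D_bracket:
  assumes q: "q \<in> M" and "vector_field M Y"
    and s: "\<And>c. structure_constant c a b = (if c = d then s else 0)"
  shows "D (lie_bracket M (E a) (E b)) Y q = s *\<^sub>R D (E d) Y q"
proof -
  have "lie_bracket M (E a) (E b) q = s *\<^sub>R E d q" if q: "q \<in> M" for q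
  proof -
    have "lie_bracket M (E a) (E b) q \<in> tangent_space M q"
      using bracket_field[OF frame frame] q unfolding vector_field_def by blast
    then have "lie_bracket M (E a) (E b) q = (\<Sum>c\<in>UNIV. structure_constant c a b *\<^sub>R E c q)"
      using frame_expansion[OF q] coframe_bracket[OF q] by (metis (no_types, lifting) sum.cong)
    also have "\<dots> = (\<Sum>c\<in>UNIV. if c = d then s *\<^sub>R E c q else 0)"
      by (intro sum.cong) (auto simp: s)
    finally show ?thesis by simp
  qed
  then have "D (\<lambda>q. s *\<^sub>R E d q) Y q = D (lie_bracket M (E a) (E b)) Y q"
    by (intro D_cong1 bracket_field frame assms)
  then show ?thesis using D_scaleR1[OF smooth_map_const frame assms(2) q] by simp
qed

lemma curvature_same:
  assumes q: "q \<in> M" and "vector_field M Y"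
  shows "curvature M D (E a) (E a) Y q = 0"
proof -
  \<comment> \<open>A degenerate instance of the bracket rule, with multiplier 0 and the arbitrary
    target \<open>None\<close>.\<close>
  have "structure_constant c a a = (if c = None then 0 else 0)" for c
    by (cases c; cases a) (auto simp: structure_constant_cyclic)
  from D_bracket[OF assms this] show ?thesis by (simp add: curvature_def)
qed

lemma deriv_quotients:
  assumes "t \<in> I"
  shows "deriv (\<lambda>t. deriv (A i) t / A i t) t = deriv (deriv (A i)) t / A i t - (deriv (A i) t / A i t)\<^sup>2"
    and "deriv (\<lambda>t. - (A i t * deriv (A i) t)) t = - ((deriv (A i) t)\<^sup>2 + A i t * deriv (deriv (A i)) t)"
proof -
  note d = smooth_map_deriv(1)[OF open_I A_smooth assms, of i]
    smooth_map_deriv(1)[OF open_I smooth_map_deriv(2)[OF open_I A_smooth] assms, of i]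
  have "A i t \<noteq> 0" using A_pos[OF assms, of i] by simp
  then show "deriv (\<lambda>t. deriv (A i) t / A i t) t = deriv (deriv (A i)) t / A i t - (deriv (A i) t / A i t)\<^sup>2"
    using d by (intro DERIV_imp_deriv) (auto intro!: derivative_eq_intros simp: field_simps power2_eq_square)
  show "deriv (\<lambda>t. - (A i t * deriv (A i) t)) t = - ((deriv (A i) t)\<^sup>2 + A i t * deriv (deriv (A i)) t)"
    using d by (intro DERIV_imp_deriv) (auto intro!: derivative_eq_intros simp: field_simps power2_eq_square)
qed

lemma quotients_smooth:
  "smooth_map I (\<lambda>t. deriv (A i) t / A i t)" "smooth_map I (\<lambda>t. - (A i t * deriv (A i) t))"
  by (intro smooth_intros A_smooth smooth_map_deriv(2)[OF open_I]; simp add: A_nonzero)+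

text \<open>The radial curves are geodesics and the two fields commute, so only the derivative of
  \<open>D (E (Some i)) (E None)\<close> along the radial field remains, and
  \<open>(A'/A)' + (A'/A)^2 = A''/A\<close>.\<close>

lemma curvature_iT:
  assumes q: "q \<in> M"
  shows "curvature M D (E (Some i)) (E None) (E None) q =
    (- (deriv (deriv (A i)) (fst q) / A i (fst q))) *\<^sub>R E (Some i) q"
proof -
  have t: "fst q \<in> I" using q by auto
  have 1: "D (E (Some i)) (D (E None) (E None)) q = 0"
    by (intro D_vanishing D_field frame D_TT q)
  have 2: "D (lie_bracket M (E (Some i)) (E None)) (E None) q = 0"
    using D_bracket[OF q frame, of "Some i" None None 0 None] by simp
  show ?thesis
    by (simp only: curvature_def 1 2
      D_multiple[OF q quotients_smooth(1) D_field[OF frame frame] D_iT] deriv_quotients[OF t] D_Ti[OF q])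
      (simp add: power2_eq_square flip: scaleR_add_left)
qed

lemma curvature_Ti:
  assumes q: "q \<in> M"
  shows "curvature M D (E None) (E (Some i)) (E (Some i)) q =
    (- (A i (fst q) * deriv (deriv (A i)) (fst q))) *\<^sub>R E None q"
proof -
  have t: "fst q \<in> I" using q by auto
  have 2: "D (lie_bracket M (E None) (E (Some i))) (E (Some i)) q = 0"
    using D_bracket[OF q frame, of None "Some i" None 0] by simp
  have "A i (fst q) \<noteq> 0" using A_nonzero[OF t] .
  then show ?thesis
    by ((simp only: curvature_def 2
      D_multiple[OF q quotients_smooth(1) D_field[OF frame frame] D_Ti]
      D_multiple[OF q quotients_smooth(2) D_field[OF frame frame] D_ii] deriv_quotients[OF t] D_ii[OF q] D_TT[OF q]),
      (simp add: power2_eq_square flip: scaleR_add_left scaleR_diff_left))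
qed

lemma D_plus': "q \<in> M \<Longrightarrow> D (E (Some (i + 2))) (E (Some i)) q = \<gamma> (i + 2) (fst q) *\<^sub>R E (Some (i + 1)) q"
  and D_minus': "q \<in> M \<Longrightarrow> D (E (Some i)) (E (Some (i + 2))) q = \<gamma>' (i + 2) (fst q) *\<^sub>R E (Some (i + 1)) q"
  using D_plus[of q "i + 2"] D_minus[of q "i + 2"] by simp_all

text \<open>The first summand comes from the second fundamental form of the slices of constant
  \<open>t\<close>, the second from the connection along the sphere, the third from the bracket,
  which is twice \<open>E (Some (i + 2))\<close>.\<close>

lemma curvature_next:
  assumes q: "q \<in> M"
  defines "t \<equiv> fst q"
  shows "curvature M D (E (Some (i + 1))) (E (Some i)) (E (Some i)) q =
    (- (A i t * deriv (A i) t * (deriv (A (i + 1)) t / A (i + 1) t))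
      - \<gamma>' i t * \<gamma>' (i + 2) t - 2 * \<gamma> (i + 2) t) *\<^sub>R E (Some (i + 1)) q"
proof -
  have 2: "D (lie_bracket M (E (Some (i + 1))) (E (Some i))) (E (Some i)) q = 2 *\<^sub>R D (E (Some (i + 2))) (E (Some i)) q"
  proof (rule D_bracket[OF q frame])
    show "structure_constant c (Some (i + 1)) (Some i) = (if c = Some (i + 2) then 2 else 0)" for c
      by (cases c) (auto simp: structure_constant_cyclic)
  qed
  show ?thesis
    by (simp only: curvature_def 2
      D_multiple[OF q quotients_smooth(2) D_field[OF frame frame] D_ii]
      D_multiple[OF q c_smooth(2) D_field[OF frame frame] D_minus]
      D_iT[OF q] D_minus'[OF q] D_plus'[OF q] t_def)
      (simp flip: scaleR_add_left scaleR_diff_left scaleR_minus_left)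
qed

lemma curvature_previous:
  assumes q: "q \<in> M"
  defines "t \<equiv> fst q"
  shows "curvature M D (E (Some (i + 2))) (E (Some i)) (E (Some i)) q =
    (- (A i t * deriv (A i) t * (deriv (A (i + 2)) t / A (i + 2) t))
      - \<gamma> (i + 2) t * \<gamma> i t + 2 * \<gamma>' i t) *\<^sub>R E (Some (i + 2)) q"
proof -
  have 2: "D (lie_bracket M (E (Some (i + 2))) (E (Some i))) (E (Some i)) q = (- 2) *\<^sub>R D (E (Some (i + 1))) (E (Some i)) q"
  proof (rule D_bracket[OF q frame])
    show "structure_constant c (Some (i + 2)) (Some i) = (if c = Some (i + 1) then - 2 else 0)" for c
      by (cases c) (auto simp: structure_constant_cyclic)
  qed
  show ?thesis
    by (simp only: curvature_def 2
      D_multiple[OF q quotients_smooth(2) D_field[OF frame frame] D_ii]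
      D_multiple[OF q c_smooth(1) D_field[OF frame frame] D_plus']
      D_iT[OF q] D_plus[OF q] D_minus[OF q] t_def)
      (simp flip: scaleR_add_left scaleR_diff_left scaleR_minus_left)
qed

lemma coframe_scaleR_frame: "q \<in> M \<Longrightarrow> \<theta> a q (r *\<^sub>R E b q) = (if a = b then r else 0)"
  by (simp add: coframe_scaleR[OF _ frame_tangent] coframe_frame)

lemma ricci_TT:
  assumes q: "q \<in> M"
  shows "ricci M D (E None) (E None) q = - (\<Sum>i\<in>UNIV. deriv (deriv (A i)) (fst q) / A i (fst q))"
  unfolding ricci_frame[OF frame frame q] sum_option curvature_iT[OF q] curvature_same[OF q frame]
    coframe_scaleR_frame[OF q] coframe_zero[OF q]
  by (simp add: sum_negf)

lemma ricci_ii: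
  assumes q: "q \<in> M"
  defines "t \<equiv> fst q"
  shows "ricci M D (E (Some i)) (E (Some i)) q =
    - A i t * deriv (deriv (A i)) t
    - A i t * deriv (A i) t * (deriv (A (i + 1)) t / A (i + 1) t + deriv (A (i + 2)) t / A (i + 2) t)
    - \<gamma>' i t * \<gamma>' (i + 2) t - 2 * \<gamma> (i + 2) t - \<gamma> (i + 2) t * \<gamma> i t + 2 * \<gamma>' i t"
  unfolding ricci_frame[OF frame frame q] sum_option sum_3_cyclic[of _ i] curvature_Ti[OF q] curvature_next[OF q]
    curvature_previous[OF q] curvature_same[OF q frame] coframe_scaleR_frame[OF q] coframe_zero[OF q] t_def
  by (simp add: algebra_simps)

end

section \<open>The ordinary differential equations\<close>

lemma quintic_coeffs_zero:
  fixes c\<^sub>0 :: real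
  assumes "infinite S"
    and "\<And>x. x \<in> S \<Longrightarrow> c\<^sub>0 + c\<^sub>1 * x + c\<^sub>2 * x^2 + c\<^sub>3 * x^3 + c\<^sub>4 * x^4 + c\<^sub>5 * x^5 = 0"
  shows "c\<^sub>0 = 0 \<and> c\<^sub>1 = 0 \<and> c\<^sub>2 = 0 \<and> c\<^sub>3 = 0 \<and> c\<^sub>4 = 0 \<and> c\<^sub>5 = 0"
proof -
  let ?p = "[:c\<^sub>0, c\<^sub>1, c\<^sub>2, c\<^sub>3, c\<^sub>4, c\<^sub>5:]"
  have "poly ?p x = 0" if "x \<in> S" for x
    using assms(2)[OF that] by (simp add: algebra_simps power_numeral_reduce)
  then have "S \<subseteq> {x. poly ?p x = 0}" by blast
  then have "?p = 0" using assms(1) poly_roots_finite finite_subset by blast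
  then show ?thesis by simp
qed

text \<open>\<open>T\<close>, \<open>R1\<close> and \<open>R2\<close> are the Ricci equations in the
  radial direction and in the directions \<open>E (Some 1)\<close> and \<open>E (Some 2)\<close>.
  The difference of \<open>T\<close> and \<open>R1\<close>, together with
  \<open>u x \<noteq> 0\<close>, fixes \<open>L\<close> up to sign; that of \<open>T\<close> and
  \<open>R2\<close> then fixes \<open>K\<close>.\<close>

lemma coefficients_determined:
  fixes k\<^sub>1 k\<^sub>2 k\<^sub>3 l\<^sub>1 l\<^sub>2 l\<^sub>3 :: real and S :: "real set" and u :: "real \<Rightarrow> real"
  assumes K_def: "\<And>x. K x = k\<^sub>1 * x\<^sup>2 + k\<^sub>2 * x + k\<^sub>3" and L_def: "\<And>x. L x = l\<^sub>1 * x\<^sup>2 + l\<^sub>2 * x + l\<^sub>3"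
    and K'_def: "\<And>x. K' x = 2 * k\<^sub>1 * x + k\<^sub>2" and L'_def: "\<And>x. L' x = 2 * l\<^sub>1 * x + l\<^sub>2"
    and S: "infinite S" and nz: "\<And>x. x \<in> S \<Longrightarrow> u x \<noteq> 0"
    and T: "\<And>x. x \<in> S \<Longrightarrow> - (K' x + 2 * x * L' x) * (K x - x * L x) = u x"
    and R1: "\<And>x. x \<in> S \<Longrightarrow> - K' x * (K x - x * L x) - 2 * K x * L x + 2 * x^3 = u x"
    and R2: "\<And>x. x \<in> S \<Longrightarrow> - x * L' x * (K x - x * L x) - K x * L x - x * (L x)\<^sup>2 + 4 * x - 2 * x^3 = u x"
  shows "\<exists>s\<in>{1, -1}. k\<^sub>1 = 2 * s \<and> k\<^sub>2 = 0 \<and> k\<^sub>3 = - s \<and> l\<^sub>1 = 0 \<and> l\<^sub>2 = s \<and> l\<^sub>3 = 0"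
proof -
  have p: "K x * L x - x^3 - x * L' x * (K x - x * L x) = 0" if "x \<in> S" for x
  proof -
    have "2 * (K x * L x - x^3 - x * L' x * (K x - x * L x)) =
        - (K' x + 2 * x * L' x) * (K x - x * L x) - (- K' x * (K x - x * L x) - 2 * K x * L x + 2 * x^3)"
      by (simp add: algebra_simps)
    then show ?thesis using T[OF that] R1[OF that] by simp
  qed
  \<comment> \<open>The term of degree 5 comes from \<open>x * L' x * (x * L x)\<close>, and its
    coefficient settles \<open>l\<^sub>1\<close>. The cubic coefficient then reduces to
    \<open>l\<^sub>2 * l\<^sub>2 - 1\<close>.\<close>
  have c: "k\<^sub>3 * l\<^sub>3 + (k\<^sub>2 * l\<^sub>3) * x
      + (k\<^sub>1 * l\<^sub>3 + k\<^sub>2 * l\<^sub>2 + k\<^sub>3 * l\<^sub>1 - 2 * l\<^sub>1 * k\<^sub>3 - l\<^sub>2 * (k\<^sub>2 - l\<^sub>3)) * x^2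
      + (k\<^sub>1 * l\<^sub>2 + k\<^sub>2 * l\<^sub>1 - 1 - 2 * l\<^sub>1 * (k\<^sub>2 - l\<^sub>3) - l\<^sub>2 * (k\<^sub>1 - l\<^sub>2)) * x^3
      + (k\<^sub>1 * l\<^sub>1 - 2 * l\<^sub>1 * (k\<^sub>1 - l\<^sub>2) + l\<^sub>1 * l\<^sub>2) * x^4 + (2 * l\<^sub>1 * l\<^sub>1) * x^5 = 0"
    if "x \<in> S" for x
    using p[OF that] unfolding K_def L_def L'_def by (simp add: algebra_simps power_numeral_reduce)
  note c = quintic_coeffs_zero[OF S c]
  have l1: "l\<^sub>1 = 0" using c by simp
  have l2: "l\<^sub>2 * l\<^sub>2 = 1" using c l1 by (simp add: algebra_simps)
  have kl: "l\<^sub>3 * (k\<^sub>1 + l\<^sub>2) = 0" "k\<^sub>2 * l\<^sub>3 = 0" "k\<^sub>3 * l\<^sub>3 = 0" using c l1 by (simp_all add: algebra_simps)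
  obtain x where x: "x \<in> S" using S by fastforce
  \<comment> \<open>With \<open>l\<^sub>1 = 0\<close> the first factor in \<open>T\<close> is
    \<open>2 * (k\<^sub>1 + l\<^sub>2) * x + k\<^sub>2\<close> up to sign. Its identical vanishing
    would force \<open>u = 0\<close> on \<open>S\<close>; this excludes the Ricci-flat
    families.\<close>
  have k1: "k\<^sub>1 + l\<^sub>2 \<noteq> 0 \<or> k\<^sub>2 \<noteq> 0"
  proof (rule ccontr)
    assume "\<not> ?thesis"
    then have "K' x + 2 * x * L' x = 0" using l1 by (simp add: K'_def L'_def algebra_simps) algebra
    then show False using T[OF x] nz[OF x] by simp
  qed
  then have l3: "l\<^sub>3 = 0" using kl by auto
  have q: "- K' x * (K x - x * L x) - x * L' x * (K x - x * L x) + K x * L x + x * (L x)\<^sup>2 - 4 * x + 2 * x^3 = 0"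
    if "x \<in> S" for x
  proof -
    have "- K' x * (K x - x * L x) - x * L' x * (K x - x * L x) + K x * L x + x * (L x)\<^sup>2 - 4 * x + 2 * x^3 =
        - (K' x + 2 * x * L' x) * (K x - x * L x)
        - (- x * L' x * (K x - x * L x) - K x * L x - x * (L x)\<^sup>2 + 4 * x - 2 * x^3)"
      by (simp add: algebra_simps)
    then show ?thesis using T[OF that] R2[OF that] by simp
  qed
  have d: "- k\<^sub>2 * k\<^sub>3 + (- (2 * k\<^sub>1 + l\<^sub>2) * k\<^sub>3 - k\<^sub>2 * k\<^sub>2 + l\<^sub>2 * k\<^sub>3 - 4) * x
      + (- (2 * k\<^sub>1 + l\<^sub>2) * k\<^sub>2 - k\<^sub>2 * (k\<^sub>1 - l\<^sub>2) + l\<^sub>2 * k\<^sub>2) * x^2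
      + (- (2 * k\<^sub>1 + l\<^sub>2) * (k\<^sub>1 - l\<^sub>2) + l\<^sub>2 * k\<^sub>1 + l\<^sub>2 * l\<^sub>2 + 2) * x^3 + 0 * x^4 + 0 * x^5 = 0"
    if "x \<in> S" for x
    using q[OF that] unfolding K_def L_def K'_def L'_def l1 l3 by (simp add: algebra_simps power_numeral_reduce)
  note d = quintic_coeffs_zero[OF S d]
  \<comment> \<open>Modulo \<open>l\<^sub>2 * l\<^sub>2 = 1\<close> the cubic coefficient is
    \<open>- 2\<close> times this product. The root \<open>k\<^sub>1 = - l\<^sub>2\<close> is
    discarded once \<open>k\<^sub>2 = 0\<close> is known.\<close>
  have k1': "(k\<^sub>1 - 2 * l\<^sub>2) * (k\<^sub>1 + l\<^sub>2) = 0"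
  proof -
    have "- (2 * k\<^sub>1 + l\<^sub>2) * (k\<^sub>1 - l\<^sub>2) + l\<^sub>2 * k\<^sub>1 + l\<^sub>2 * l\<^sub>2 + 2 = 0" using d by blast
    then show ?thesis using l2 by algebra
  qed
  have "k\<^sub>2 * (l\<^sub>2 - 3 * k\<^sub>1) = 0" using d by (simp add: algebra_simps)
  moreover have "l\<^sub>2 \<noteq> 3 * k\<^sub>1"
  proof
    assume "l\<^sub>2 = 3 * k\<^sub>1"
    then have "k\<^sub>1 * k\<^sub>1 = 0" using k1' by (simp add: algebra_simps)
    then show False using l2 \<open>l\<^sub>2 = 3 * k\<^sub>1\<close> by simp
  qed
  ultimately have k2: "k\<^sub>2 = 0" by simp
  then have k1: "k\<^sub>1 = 2 * l\<^sub>2" using k1 k1' by simp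
  have "2 * k\<^sub>1 * k\<^sub>3 = - 4" using d k2 by (simp add: algebra_simps)
  then have k3: "k\<^sub>3 = - l\<^sub>2" using k1 l2 by algebra
  have "l\<^sub>2 \<in> {1, -1}" using l2 by (simp add: square_eq_1_iff)
  then show ?thesis using k1 k2 k3 l1 l3 by blast
qed

lemma constant_on_interval:
  fixes f :: "real \<Rightarrow> real"
  assumes "is_interval I" "\<And>t. t \<in> I \<Longrightarrow> (f has_real_derivative 0) (at t)"
  shows "\<exists>c. \<forall>t\<in>I. f t = c"
  by (rule has_field_derivative_zero_constant)
    (auto intro: has_field_derivative_at_within is_interval_convex assms)

section \<open>Reduction to polynomial identities in the ratio of the radial functions, and
  integration\<close>

locale biaxial_ode =
  fixes I :: "real set" and A\<^sub>1 A\<^sub>2 :: "real \<Rightarrow> real" and k\<^sub>1 k\<^sub>2 k\<^sub>3 l\<^sub>1 l\<^sub>2 l\<^sub>3 c :: real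
  assumes I: "open I" "is_interval I" "I \<noteq> {}"
    and pos: "\<And>t. t \<in> I \<Longrightarrow> A\<^sub>1 t > 0" "\<And>t. t \<in> I \<Longrightarrow> A\<^sub>2 t > 0"
    and d: "\<And>t. t \<in> I \<Longrightarrow> (A\<^sub>1 has_real_derivative deriv A\<^sub>1 t) (at t)"
      "\<And>t. t \<in> I \<Longrightarrow> (A\<^sub>2 has_real_derivative deriv A\<^sub>2 t) (at t)"
    and ode1: "\<And>t. t \<in> I \<Longrightarrow> deriv A\<^sub>1 t = k\<^sub>1 * (A\<^sub>1 t / A\<^sub>2 t)\<^sup>2 + k\<^sub>2 * (A\<^sub>1 t / A\<^sub>2 t) + k\<^sub>3"
    and ode2: "\<And>t. t \<in> I \<Longrightarrow> deriv A\<^sub>2 t = l\<^sub>1 * (A\<^sub>1 t / A\<^sub>2 t)\<^sup>2 + l\<^sub>2 * (A\<^sub>1 t / A\<^sub>2 t) + l\<^sub>3"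
    and ric_T: "\<And>t. t \<in> I \<Longrightarrow> - (deriv (deriv A\<^sub>1) t / A\<^sub>1 t + 2 * (deriv (deriv A\<^sub>2) t / A\<^sub>2 t)) = c"
    and ric_1: "\<And>t. t \<in> I \<Longrightarrow> - A\<^sub>1 t * deriv (deriv A\<^sub>1) t
        - 2 * A\<^sub>1 t * deriv A\<^sub>1 t * (deriv A\<^sub>2 t / A\<^sub>2 t) + 2 * (A\<^sub>1 t / A\<^sub>2 t)^4 = c * (A\<^sub>1 t)\<^sup>2"
    and ric_2: "\<And>t. t \<in> I \<Longrightarrow> - A\<^sub>2 t * deriv (deriv A\<^sub>2) t
        - A\<^sub>2 t * deriv A\<^sub>2 t * (deriv A\<^sub>1 t / A\<^sub>1 t + deriv A\<^sub>2 t / A\<^sub>2 t) + 4 - 2 * (A\<^sub>1 t / A\<^sub>2 t)\<^sup>2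
        = c * (A\<^sub>2 t)\<^sup>2"
    and c: "c \<noteq> 0"
begin

definition "x t = A\<^sub>1 t / A\<^sub>2 t"
definition "K y = k\<^sub>1 * y\<^sup>2 + k\<^sub>2 * y + k\<^sub>3"
definition "L y = l\<^sub>1 * y\<^sup>2 + l\<^sub>2 * y + l\<^sub>3"
definition "K' y = 2 * k\<^sub>1 * y + k\<^sub>2"
definition "L' y = 2 * l\<^sub>1 * y + l\<^sub>2"

lemma x_pos: "t \<in> I \<Longrightarrow> x t > 0"
  using pos by (simp add: x_def)

lemma A1_x: "t \<in> I \<Longrightarrow> A\<^sub>1 t = x t * A\<^sub>2 t"
  using pos(2)[of t] by (simp add: x_def)

lemma deriv_A: "t \<in> I \<Longrightarrow> deriv A\<^sub>1 t = K (x t)" "t \<in> I \<Longrightarrow> deriv A\<^sub>2 t = L (x t)"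
  using ode1 ode2 by (auto simp: K_def L_def x_def)

lemma x_deriv:
  assumes t: "t \<in> I"
  shows "(x has_real_derivative (K (x t) - x t * L (x t)) / A\<^sub>2 t) (at t)"
proof -
  have "((\<lambda>t. A\<^sub>1 t / A\<^sub>2 t) has_real_derivative (deriv A\<^sub>1 t * A\<^sub>2 t - A\<^sub>1 t * deriv A\<^sub>2 t) / (A\<^sub>2 t * A\<^sub>2 t)) (at t)"
    using d[OF t] pos(2)[OF t] by (intro DERIV_divide) auto
  moreover have "(deriv A\<^sub>1 t * A\<^sub>2 t - A\<^sub>1 t * deriv A\<^sub>2 t) / (A\<^sub>2 t * A\<^sub>2 t) = (K (x t) - x t * L (x t)) / A\<^sub>2 t"
    using pos(2)[OF t] by (simp add: deriv_A[OF t] A1_x[OF t] field_simps)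
  ultimately show ?thesis unfolding x_def[abs_def] by simp
qed

lemma deriv2_A:
  assumes t: "t \<in> I"
  shows "deriv (deriv A\<^sub>1) t = K' (x t) * (K (x t) - x t * L (x t)) / A\<^sub>2 t"
    and "deriv (deriv A\<^sub>2) t = L' (x t) * (K (x t) - x t * L (x t)) / A\<^sub>2 t"
proof -
  define x' where "x' = (K (x t) - x t * L (x t)) / A\<^sub>2 t"
  note x' = x_deriv[OF t, folded x'_def]
  have "((\<lambda>t. K (x t)) has_real_derivative K' (x t) * ((K (x t) - x t * L (x t)) / A\<^sub>2 t)) (at t)"
    unfolding x'_def[symmetric] unfolding K_def K'_def using x'
    by (auto intro!: derivative_eq_intros simp: algebra_simps)
  then have "(deriv A\<^sub>1 has_real_derivative K' (x t) * ((K (x t) - x t * L (x t)) / A\<^sub>2 t)) (at t)"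
    by (rule has_field_derivative_transform_within_open[OF _ I(1) t]) (simp add: deriv_A)
  then show "deriv (deriv A\<^sub>1) t = K' (x t) * (K (x t) - x t * L (x t)) / A\<^sub>2 t"
    by (simp add: DERIV_imp_deriv)
  have "((\<lambda>t. L (x t)) has_real_derivative L' (x t) * ((K (x t) - x t * L (x t)) / A\<^sub>2 t)) (at t)"
    unfolding x'_def[symmetric] unfolding L_def L'_def using x'
    by (auto intro!: derivative_eq_intros simp: algebra_simps)
  then have "(deriv A\<^sub>2 has_real_derivative L' (x t) * ((K (x t) - x t * L (x t)) / A\<^sub>2 t)) (at t)"
    by (rule has_field_derivative_transform_within_open[OF _ I(1) t]) (simp add: deriv_A)
  then show "deriv (deriv A\<^sub>2) t = L' (x t) * (K (x t) - x t * L (x t)) / A\<^sub>2 t"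
    by (simp add: DERIV_imp_deriv)
qed

text \<open>The common right-hand side is chosen to clear all denominators: \<open>ric_T\<close> is
  multiplied by \<open>(A\<^sub>2 t)\<^sup>2 * y\<close>, \<open>ric_1\<close> divided by
  \<open>y\<close>, and \<open>ric_2\<close> multiplied by \<open>y\<close>.\<close>

lemma polynomial_equations:
  assumes t: "t \<in> I"
  defines "y \<equiv> x t"
  shows "- (K' y + 2 * y * L' y) * (K y - y * L y) = c * (A\<^sub>2 t)\<^sup>2 * y"
    and "- K' y * (K y - y * L y) - 2 * K y * L y + 2 * y^3 = c * (A\<^sub>2 t)\<^sup>2 * y"
    and "- y * L' y * (K y - y * L y) - K y * L y - y * (L y)\<^sup>2 + 4 * y - 2 * y^3 = c * (A\<^sub>2 t)\<^sup>2 * y"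
proof -
  have y: "y > 0" and b: "A\<^sub>2 t > 0" using x_pos pos t by (auto simp: y_def)
  have a: "A\<^sub>1 t = y * A\<^sub>2 t" "A\<^sub>1 t / A\<^sub>2 t = y" using A1_x[OF t] by (auto simp: y_def x_def)
  note e = deriv2_A[OF t] deriv_A[OF t]
  define m where "m = K y - y * L y"
  have "c * (A\<^sub>2 t)\<^sup>2 * y = - (K' y * m / A\<^sub>2 t / (y * A\<^sub>2 t) + 2 * (L' y * m / A\<^sub>2 t / A\<^sub>2 t)) * (A\<^sub>2 t)\<^sup>2 * y"
    using ric_T[OF t] unfolding e a(1) m_def y_def[symmetric] by simp
  also have "\<dots> = - (K' y + 2 * y * L' y) * m" using y b by (simp add: field_simps power2_eq_square)
  finally show "- (K' y + 2 * y * L' y) * (K y - y * L y) = c * (A\<^sub>2 t)\<^sup>2 * y" by (simp add: m_def)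
  have "c * (y * A\<^sub>2 t)\<^sup>2 = - (y * A\<^sub>2 t) * (K' y * m / A\<^sub>2 t) - 2 * (y * A\<^sub>2 t) * K y * (L y / A\<^sub>2 t) + 2 * y^4"
    using ric_1[OF t] unfolding a(2) unfolding e a(1) m_def y_def[symmetric] by simp
  also have "\<dots> = y * (- K' y * m - 2 * K y * L y + 2 * y^3)"
    using b by (simp add: field_simps power_numeral_reduce)
  finally have "y * (- K' y * m - 2 * K y * L y + 2 * y^3) = y * (c * (A\<^sub>2 t)\<^sup>2 * y)"
    by (simp add: power2_eq_square algebra_simps)
  then show "- K' y * (K y - y * L y) - 2 * K y * L y + 2 * y^3 = c * (A\<^sub>2 t)\<^sup>2 * y"
    using y by (simp add: m_def)
  have "c * (A\<^sub>2 t)\<^sup>2 = - A\<^sub>2 t * (L' y * m / A\<^sub>2 t) - A\<^sub>2 t * L y * (K y / (y * A\<^sub>2 t) + L y / A\<^sub>2 t) + 4 - 2 * y\<^sup>2"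
    using ric_2[OF t] unfolding a(2) unfolding e a(1) m_def y_def[symmetric] by simp
  also have "\<dots> = - L' y * m - K y * L y / y - (L y)\<^sup>2 + 4 - 2 * y\<^sup>2"
    using y b by (simp add: field_simps power2_eq_square)
  finally have *: "c * (A\<^sub>2 t)\<^sup>2 = - L' y * m - K y * L y / y - (L y)\<^sup>2 + 4 - 2 * y\<^sup>2" .
  have "K y * L y = K y * L y / y * y" using y by simp
  then show "- y * L' y * (K y - y * L y) - K y * L y - y * (L y)\<^sup>2 + 4 * y - 2 * y^3 = c * (A\<^sub>2 t)\<^sup>2 * y"
    unfolding * m_def[symmetric] by algebra
qed

text \<open>A finite connected image is a single point; then the vanishing derivative of
  \<open>x\<close> kills the factor \<open>K y - y * L y\<close> of the first polynomial equation,
  whose other side is nonzero.\<close>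

lemma infinite_x: "infinite (x ` I)"
proof
  assume fin: "finite (x ` I)"
  have "continuous_on I x"
    using x_deriv by (auto intro!: continuous_at_imp_continuous_on intro: DERIV_isCont)
  then have "connected (x ` I)"
    using I(2) by (intro connected_continuous_image is_interval_connected)
  with fin obtain y where "x ` I = {y}" using I(3) connected_finite_iff_sing[of "x ` I"] by auto
  then have y: "x t = y" if "t \<in> I" for t using that imageI[of t I x] by auto
  obtain t where t: "t \<in> I" using I(3) by blast
  have x0: "(x has_real_derivative 0) (at t)"
    by (rule has_field_derivative_transform_within_open[OF DERIV_const[of y] I(1) t]) (simp add: y)
  have "K (x t) - x t * L (x t) = 0"
    using DERIV_unique[OF x_deriv[OF t] x0] pos(2)[OF t] by simp
  then have "c * (A\<^sub>2 t)\<^sup>2 * x t = 0" using polynomial_equations(1)[OF t] by simp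
  then show False using c x_pos[OF t] pos(2)[OF t] by simp
qed

lemma solution:
  obtains s where "s \<in> {1, -1}" "k\<^sub>1 = 2 * s" "k\<^sub>2 = 0" "k\<^sub>3 = - s" "l\<^sub>1 = 0" "l\<^sub>2 = s" "l\<^sub>3 = 0"
    "\<And>t. t \<in> I \<Longrightarrow> (A\<^sub>2 has_real_derivative s * x t) (at t)"
    "\<And>t. t \<in> I \<Longrightarrow> c * (A\<^sub>2 t)\<^sup>2 = 6 * (1 - (x t)\<^sup>2)"
proof -
  define u where "u y = - (K' y + 2 * y * L' y) * (K y - y * L y)" for y
  have "\<exists>s\<in>{1, -1}. k\<^sub>1 = 2 * s \<and> k\<^sub>2 = 0 \<and> k\<^sub>3 = - s \<and> l\<^sub>1 = 0 \<and> l\<^sub>2 = s \<and> l\<^sub>3 = 0"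
  proof (rule coefficients_determined[of K k\<^sub>1 k\<^sub>2 k\<^sub>3 L l\<^sub>1 l\<^sub>2 l\<^sub>3 K' L' "x ` I" u, OF K_def L_def K'_def L'_def infinite_x])
    fix y assume "y \<in> x ` I"
    then obtain t where t: "t \<in> I" "y = x t" by blast
    note p = polynomial_equations[OF t(1), folded t(2)]
    show "u y \<noteq> 0" using p(1) c x_pos[OF t(1)] pos(2)[OF t(1)] t(2) by (simp add: u_def)
    show "- (K' y + 2 * y * L' y) * (K y - y * L y) = u y" by (simp add: u_def)
    show "- K' y * (K y - y * L y) - 2 * K y * L y + 2 * y^3 = u y" using p(1,2) by (simp add: u_def)
    show "- y * L' y * (K y - y * L y) - K y * L y - y * (L y)\<^sup>2 + 4 * y - 2 * y^3 = u y"
      using p(1,3) by (simp add: u_def)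
  qed
  then obtain s where s: "s \<in> {1, -1}" "k\<^sub>1 = 2 * s" "k\<^sub>2 = 0" "k\<^sub>3 = - s" "l\<^sub>1 = 0" "l\<^sub>2 = s" "l\<^sub>3 = 0"
    by blast
  show ?thesis
  proof (rule that[OF s])
    fix t assume t: "t \<in> I"
    show "(A\<^sub>2 has_real_derivative s * x t) (at t)"
      using d(2)[OF t] unfolding deriv_A(2)[OF t] L_def unfolding s(2-) by simp
    \<comment> \<open>Here \<open>K - x L = s (x^2 - 1)\<close> and
      \<open>K' + 2 x L' = 6 s x\<close>, so the first polynomial equation becomes the claim
      multiplied by \<open>x t\<close>.\<close>
    have "s * s = 1" using s(1) by auto
    then have "c * (A\<^sub>2 t)\<^sup>2 * x t = 6 * (1 - (x t)\<^sup>2) * x t"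
      using polynomial_equations(1)[OF t] unfolding K_def L_def K'_def L'_def unfolding s(2-) by algebra
    then show "c * (A\<^sub>2 t)\<^sup>2 = 6 * (1 - (x t)\<^sup>2)" using x_pos[OF t] by simp
  qed
qed

text \<open>With \<open>\<alpha> * A\<^sub>2 t\<close> as the sine of an angle, positivity makes
  \<open>x t\<close> its cosine. The angle then has derivative \<open>\<alpha> * s\<close>, and
  \<open>A\<^sub>1 = x A\<^sub>2\<close> is the double-angle formula.\<close>

lemma trigonometric_solution:
  assumes s: "s \<in> {1, -1}" and \<alpha>: "\<alpha> > 0"
    and A2: "\<And>t. t \<in> I \<Longrightarrow> (A\<^sub>2 has_real_derivative s * x t) (at t)"
    and x2: "\<And>t. t \<in> I \<Longrightarrow> (x t)\<^sup>2 = 1 - (\<alpha> * A\<^sub>2 t)\<^sup>2"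
  obtains C where "\<And>t. t \<in> I \<Longrightarrow> s * t + C \<in> {0<..<pi / (2 * \<alpha>)}"
    "\<And>t. t \<in> I \<Longrightarrow> A\<^sub>1 t = sin (2 * \<alpha> * (s * t + C)) / (2 * \<alpha>)"
    "\<And>t. t \<in> I \<Longrightarrow> A\<^sub>2 t = sin (\<alpha> * (s * t + C)) / \<alpha>"
proof -
  \<comment> \<open>The strict bounds keep \<open>arcsin\<close> away from its singular points and
    later place the parameter in the open range.\<close>
  have lt1: "\<alpha> * A\<^sub>2 t < 1" "0 < \<alpha> * A\<^sub>2 t" if "t \<in> I" for t
  proof -
    show "0 < \<alpha> * A\<^sub>2 t" using \<alpha> pos that by simp
    have "0 < (x t)\<^sup>2" using x_pos[OF that] by simp
    then have "(\<alpha> * A\<^sub>2 t)\<^sup>2 < 1\<^sup>2" using x2[OF that] by simp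
    then show "\<alpha> * A\<^sub>2 t < 1" by (rule power_less_imp_less_base) simp
  qed
  have xs: "x t = sqrt (1 - (\<alpha> * A\<^sub>2 t)\<^sup>2)" if "t \<in> I" for t
    using x2[OF that] x_pos[OF that] by (metis real_sqrt_unique less_imp_le)
  have "\<exists>C. \<forall>t\<in>I. arcsin (\<alpha> * A\<^sub>2 t) - \<alpha> * s * t = C"
  proof (rule constant_on_interval[OF I(2)])
    fix t assume t: "t \<in> I"
    have "((\<lambda>t. arcsin (\<alpha> * A\<^sub>2 t) - \<alpha> * s * t) has_real_derivative
        inverse (sqrt (1 - (\<alpha> * A\<^sub>2 t)\<^sup>2)) * (\<alpha> * (s * x t)) - \<alpha> * s) (at t)"
      using lt1[OF t]
      by (auto intro!: derivative_eq_intros DERIV_chain2[OF DERIV_arcsin] A2[OF t])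
    moreover have "inverse (x t) * (\<alpha> * (s * x t)) - \<alpha> * s = 0"
      using x_pos[OF t] by (simp add: field_simps)
    ultimately show "((\<lambda>t. arcsin (\<alpha> * A\<^sub>2 t) - \<alpha> * s * t) has_real_derivative 0) (at t)"
      unfolding xs[OF t, symmetric] by simp
  qed
  then obtain C where C: "\<And>t. t \<in> I \<Longrightarrow> arcsin (\<alpha> * A\<^sub>2 t) - \<alpha> * s * t = C" by blast
  have arg: "\<alpha> * (s * t + C / \<alpha>) = arcsin (\<alpha> * A\<^sub>2 t)" if "t \<in> I" for t
    using C[OF that] \<alpha> by (simp add: field_simps)
  show ?thesis
  proof (rule that[of "C / \<alpha>"])
    fix t assume t: "t \<in> I"
    have sin: "sin (\<alpha> * (s * t + C / \<alpha>)) = \<alpha> * A\<^sub>2 t"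
      unfolding arg[OF t] using lt1[OF t] by (intro sin_arcsin) auto
    then show "A\<^sub>2 t = sin (\<alpha> * (s * t + C / \<alpha>)) / \<alpha>" using \<alpha> by simp
    have "cos (\<alpha> * (s * t + C / \<alpha>)) = x t"
      unfolding arg[OF t] xs[OF t] using lt1[OF t] by (intro cos_arcsin) auto
    then show "A\<^sub>1 t = sin (2 * \<alpha> * (s * t + C / \<alpha>)) / (2 * \<alpha>)"
      using sin_double[of "\<alpha> * (s * t + C / \<alpha>)"] sin \<alpha> A1_x[OF t] by (simp add: mult.assoc)
    have "arcsin 0 < arcsin (\<alpha> * A\<^sub>2 t)" "arcsin (\<alpha> * A\<^sub>2 t) < arcsin 1"
      using lt1[OF t] by (intro arcsin_less_arcsin; simp)+
    then have "0 < \<alpha> * (s * t + C / \<alpha>)" "\<alpha> * (s * t + C / \<alpha>) < pi / 2"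
      unfolding arg[OF t] by simp_all
    moreover have "0 < y \<and> y < pi / (2 * \<alpha>)" if "0 < \<alpha> * y" "\<alpha> * y < pi / 2" for y
    proof
      show "0 < y" using that(1) \<alpha> by (simp add: zero_less_mult_iff)
      show "y < pi / (2 * \<alpha>)" using that(2) \<alpha> by (simp add: pos_less_divide_eq mult_ac)
    qed
    ultimately show "s * t + C / \<alpha> \<in> {0<..<pi / (2 * \<alpha>)}"
      unfolding greaterThanLessThan_iff by blast
  qed
qed

lemma hyperbolic_solution:
  assumes s: "s \<in> {1, -1}" and \<alpha>: "\<alpha> > 0"
    and A2: "\<And>t. t \<in> I \<Longrightarrow> (A\<^sub>2 has_real_derivative s * x t) (at t)"
    and x2: "\<And>t. t \<in> I \<Longrightarrow> (x t)\<^sup>2 = 1 + (\<alpha> * A\<^sub>2 t)\<^sup>2"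
  obtains C where "\<And>t. t \<in> I \<Longrightarrow> s * t + C \<in> {0<..}"
    "\<And>t. t \<in> I \<Longrightarrow> A\<^sub>1 t = sinh (2 * \<alpha> * (s * t + C)) / (2 * \<alpha>)"
    "\<And>t. t \<in> I \<Longrightarrow> A\<^sub>2 t = sinh (\<alpha> * (s * t + C)) / \<alpha>"
proof -
  have xs: "x t = sqrt ((\<alpha> * A\<^sub>2 t)\<^sup>2 + 1)" if "t \<in> I" for t
    using x2[OF that] x_pos[OF that] by (metis real_sqrt_unique less_imp_le add.commute)
  have "\<exists>C. \<forall>t\<in>I. arsinh (\<alpha> * A\<^sub>2 t) - \<alpha> * s * t = C"
  proof (rule constant_on_interval[OF I(2)])
    fix t assume t: "t \<in> I"
    have "((\<lambda>t. arsinh (\<alpha> * A\<^sub>2 t) - \<alpha> * s * t) has_real_derivative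
        (1 / sqrt ((\<alpha> * A\<^sub>2 t)\<^sup>2 + 1)) * (\<alpha> * (s * x t)) - \<alpha> * s) (at t)"
      by (auto intro!: derivative_eq_intros DERIV_chain2[OF arsinh_real_has_field_derivative] A2[OF t])
    moreover have "1 / x t * (\<alpha> * (s * x t)) - \<alpha> * s = 0"
      using x_pos[OF t] by (simp add: field_simps)
    ultimately show "((\<lambda>t. arsinh (\<alpha> * A\<^sub>2 t) - \<alpha> * s * t) has_real_derivative 0) (at t)"
      unfolding xs[OF t, symmetric] by simp
  qed
  then obtain C where C: "\<And>t. t \<in> I \<Longrightarrow> arsinh (\<alpha> * A\<^sub>2 t) - \<alpha> * s * t = C" by blast
  have arg: "\<alpha> * (s * t + C / \<alpha>) = arsinh (\<alpha> * A\<^sub>2 t)" if "t \<in> I" for t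
    using C[OF that] \<alpha> by (simp add: field_simps)
  show ?thesis
  proof (rule that[of "C / \<alpha>"])
    fix t assume t: "t \<in> I"
    have sinh: "sinh (\<alpha> * (s * t + C / \<alpha>)) = \<alpha> * A\<^sub>2 t"
      unfolding arg[OF t] by simp
    then show "A\<^sub>2 t = sinh (\<alpha> * (s * t + C / \<alpha>)) / \<alpha>" using \<alpha> by simp
    have "cosh (\<alpha> * (s * t + C / \<alpha>)) = x t"
      unfolding arg[OF t] xs[OF t] by (simp add: cosh_arsinh_real)
    then show "A\<^sub>1 t = sinh (2 * \<alpha> * (s * t + C / \<alpha>)) / (2 * \<alpha>)"
      using sinh_double[of "\<alpha> * (s * t + C / \<alpha>)"] sinh \<alpha> A1_x[OF t] by (simp add: mult.assoc)
    have "0 < sinh (\<alpha> * (s * t + C / \<alpha>))" using sinh \<alpha> pos(2)[OF t] by simp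
    then show "s * t + C / \<alpha> \<in> {0<..}"
      using \<alpha> by (simp add: zero_less_mult_iff)
  qed
qed

end

section \<open>Biaxial metrics\<close>

text \<open>The map is affine in \<open>t\<close> and the identity on the sphere;
  \<open>s * s = 1\<close> both supplies the inverse and preserves the radial part of the
  metric.\<close>

lemma isometric_biaxial:
  assumes I: "open I" and s: "s \<in> {1, -1}" and sub: "(\<lambda>t. s * t + C) ` I \<subseteq> R"
    and B: "\<And>t. t \<in> I \<Longrightarrow> A\<^sub>1 t = B\<^sub>1 (s * t + C)" "\<And>t. t \<in> I \<Longrightarrow> A\<^sub>2 t = B\<^sub>2 (s * t + C)"
  shows "isometric_up_to_shift_and_sign I (biaxial_metric e A\<^sub>1 A\<^sub>2) R (biaxial_metric e B\<^sub>1 B\<^sub>2)"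
proof -
  let ?f = "\<lambda>t. s * t + C" and ?\<phi> = "\<lambda>(t, p). (s * t + C, p :: real^4)"
  let ?\<psi> = "\<lambda>q. (s * (fst q - C), snd q :: real^4)"
  have ss: "s * s = 1" "s * (s * r) = r" for r using s by auto
  have \<phi>: "?\<phi> = (\<lambda>q. (s * fst q, snd q) + (C, 0))" by auto
  have \<psi>: "?\<psi> = (\<lambda>q. (s * fst q, snd q) + (- s * C, 0))" by (auto simp: algebra_simps)
  have lin: "bounded_linear (\<lambda>q :: real \<times> (real^4). (s * fst q, snd q))"
    by (intro bounded_linear_Pair bounded_linear_const_mult bounded_linear_fst bounded_linear_snd)
  have inj: "inj_on ?\<phi> (I \<times> S3)" using s by (auto simp: inj_on_def)
  have img: "?\<phi> ` (I \<times> S3) = ?f ` I \<times> S3" by force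
  have "smooth_map (?f ` I \<times> S3) (inv_into (I \<times> S3) ?\<phi>)"
  proof (rule smooth_map_cong[of _ ?\<psi>])
    show "smooth_map (?f ` I \<times> S3) ?\<psi>"
      unfolding \<psi> by (intro smooth_map_add smooth_map_linear lin smooth_map_const)
    fix q assume "q \<in> ?f ` I \<times> S3"
    then obtain t p where q: "q = (s * t + C, p)" "t \<in> I" "p \<in> S3" by blast
    have "inv_into (I \<times> S3) ?\<phi> (?\<phi> (t, p)) = (t, p)"
      by (rule inv_into_f_f[OF inj]) (use q in auto)
    then show "?\<psi> q = inv_into (I \<times> S3) ?\<phi> q" using q by (simp add: ss)
  qed
  moreover have "smooth_map (I \<times> S3) ?\<phi>"
    unfolding \<phi> by (intro smooth_map_add smooth_map_linear lin smooth_map_const)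
  moreover have "biaxial_metric e B\<^sub>1 B\<^sub>2 (?\<phi> q) (differential (I \<times> S3) ?\<phi> q v) (differential (I \<times> S3) ?\<phi> q w)
      = biaxial_metric e A\<^sub>1 A\<^sub>2 q v w"
    if q: "q \<in> I \<times> S3" and v: "v \<in> tangent_space (I \<times> S3) q" and w: "w \<in> tangent_space (I \<times> S3) q" for q v w
  proof -
    have "(?\<phi> has_derivative (\<lambda>v. (s * fst v, snd v))) (at q within I \<times> S3)"
      unfolding \<phi>
      by (rule has_derivative_eq_rhs[OF has_derivative_add[OF bounded_linear_imp_has_derivative[OF lin] has_derivative_const]])
        simp
    from differential_eq[OF this q] v w
    have "differential (I \<times> S3) ?\<phi> q v = (s * fst v, snd v)" "differential (I \<times> S3) ?\<phi> q w = (s * fst w, snd w)"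
      by blast+
    then show ?thesis
      using q B ss by (cases q; cases v; cases w) (auto simp: biaxial_metric_def mult_ac)
  qed
  ultimately have "isometry (I \<times> S3) (biaxial_metric e A\<^sub>1 A\<^sub>2) (?f ` I \<times> S3) (biaxial_metric e B\<^sub>1 B\<^sub>2) ?\<phi>"
    unfolding isometry_def bij_betw_def using inj img by blast
  then show ?thesis
    unfolding isometric_up_to_shift_and_sign_def using s sub by blast
qed

lemma (in diagonal_metric) einstein_equations:
  assumes ric: "\<And>X Y p. vector_field M X \<Longrightarrow> vector_field M Y \<Longrightarrow> p \<in> M \<Longrightarrow> ricci M D X Y p = c * g p (X p) (Y p)"
    and A: "A = (\<lambda>i. if i = 1 then A\<^sub>1 else A\<^sub>2)" and t: "t \<in> I"
  shows "- (deriv (deriv A\<^sub>1) t / A\<^sub>1 t + 2 * (deriv (deriv A\<^sub>2) t / A\<^sub>2 t)) = c"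
    and "- A\<^sub>1 t * deriv (deriv A\<^sub>1) t - 2 * A\<^sub>1 t * deriv A\<^sub>1 t * (deriv A\<^sub>2 t / A\<^sub>2 t) + 2 * (A\<^sub>1 t / A\<^sub>2 t)^4
      = c * (A\<^sub>1 t)\<^sup>2"
    and "- A\<^sub>2 t * deriv (deriv A\<^sub>2) t - A\<^sub>2 t * deriv A\<^sub>2 t * (deriv A\<^sub>1 t / A\<^sub>1 t + deriv A\<^sub>2 t / A\<^sub>2 t)
      + 4 - 2 * (A\<^sub>1 t / A\<^sub>2 t)\<^sup>2 = c * (A\<^sub>2 t)\<^sup>2"
proof -
  \<comment> \<open>Any point of the sphere serves, since the Ricci components in the frame depend
    on \<open>t\<close> only.\<close>
  let ?q = "(t, axis 1 1 :: real^4)"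
  have q: "?q \<in> M" using t by (simp add: norm_axis_1)
  have g: "g ?q (E a ?q) (E a ?q) = h a t" for a
    using g_frame[OF q] coframe_frame[OF q] by simp
  have pos: "A\<^sub>1 t > 0" "A\<^sub>2 t > 0" using A_pos[OF t, of 1] A_pos[OF t, of 2] by (simp_all add: A)
  have h: "h None t = 1" "h (Some 1) t = (A\<^sub>1 t)\<^sup>2" "h (Some 2) t = (A\<^sub>2 t)\<^sup>2"
    unfolding h_def by (simp_all add: A)
  have r: "ricci M D (E a) (E a) ?q = c * h a t" for a
    using ric[OF frame frame q, of a a] by (simp only: g)
  show "- (deriv (deriv A\<^sub>1) t / A\<^sub>1 t + 2 * (deriv (deriv A\<^sub>2) t / A\<^sub>2 t)) = c"
    using r[of None] unfolding ricci_TT[OF q] h by (simp add: sum_3 A)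
  have 1: "- \<gamma>' 1 t * \<gamma>' (1 + 2) t - 2 * \<gamma> (1 + 2) t - \<gamma> (1 + 2) t * \<gamma> 1 t + 2 * \<gamma>' 1 t = 2 * (A\<^sub>1 t / A\<^sub>2 t)^4"
    unfolding \<gamma>_def \<gamma>'_def unfolding A using pos by (simp add: field_simps power_numeral_reduce)
  show "- A\<^sub>1 t * deriv (deriv A\<^sub>1) t - 2 * A\<^sub>1 t * deriv A\<^sub>1 t * (deriv A\<^sub>2 t / A\<^sub>2 t) + 2 * (A\<^sub>1 t / A\<^sub>2 t)^4
      = c * (A\<^sub>1 t)\<^sup>2"
    using r[of "Some 1"] 1 unfolding ricci_ii[OF q] h by (simp add: A algebra_simps)
  \<comment> \<open>The index \<open>2 + 2\<close> is 1 modulo 3, so the radial functions at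
    \<open>2\<close>, \<open>2 + 1\<close>, \<open>2 + 2\<close> are \<open>A\<^sub>2\<close>,
    \<open>A\<^sub>2\<close>, \<open>A\<^sub>1\<close>.\<close>
  have 2: "- \<gamma>' 2 t * \<gamma>' (2 + 2) t - 2 * \<gamma> (2 + 2) t - \<gamma> (2 + 2) t * \<gamma> 2 t + 2 * \<gamma>' 2 t = 4 - 2 * (A\<^sub>1 t / A\<^sub>2 t)\<^sup>2"
    unfolding \<gamma>_def \<gamma>'_def unfolding A using pos by (simp add: field_simps power_numeral_reduce)
  show "- A\<^sub>2 t * deriv (deriv A\<^sub>2) t - A\<^sub>2 t * deriv A\<^sub>2 t * (deriv A\<^sub>1 t / A\<^sub>1 t + deriv A\<^sub>2 t / A\<^sub>2 t)
      + 4 - 2 * (A\<^sub>1 t / A\<^sub>2 t)\<^sup>2 = c * (A\<^sub>2 t)\<^sup>2"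
    using r[of "Some 2"] 2 unfolding ricci_ii[OF q] h by (simp add: A algebra_simps)
qed

theorem theorem2:
  fixes e :: "3 \<Rightarrow> real^4 \<Rightarrow> real^4 \<Rightarrow> real"
    and I :: "real set"
    and A\<^sub>1 A\<^sub>2 :: "real \<Rightarrow> real"
    and k\<^sub>1 k\<^sub>2 k\<^sub>3 l\<^sub>1 l\<^sub>2 l\<^sub>3 :: real
  assumes coframe: "S3_coframe e"
    and interval: "open I" "is_interval I" "I \<noteq> {}"
    and smooth: "smooth_map I A\<^sub>1" "smooth_map I A\<^sub>2"
    and pos: "\<And>t. t \<in> I \<Longrightarrow> A\<^sub>1 t > 0" "\<And>t. t \<in> I \<Longrightarrow> A\<^sub>2 t > 0"
    and einstein: "einstein (I \<times> S3) (biaxial_metric e A\<^sub>1 A\<^sub>2)"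
    and not_ricci_flat: "\<not> ricci_flat (I \<times> S3) (biaxial_metric e A\<^sub>1 A\<^sub>2)"
    and not_coincide: "\<exists>t\<in>I. A\<^sub>1 t \<noteq> A\<^sub>2 t"
    and ode1: "\<And>t. t \<in> I \<Longrightarrow> deriv A\<^sub>1 t = k\<^sub>1 * (A\<^sub>1 t / A\<^sub>2 t)\<^sup>2 + k\<^sub>2 * (A\<^sub>1 t / A\<^sub>2 t) + k\<^sub>3"
    and ode2: "\<And>t. t \<in> I \<Longrightarrow> deriv A\<^sub>2 t = l\<^sub>1 * (A\<^sub>1 t / A\<^sub>2 t)\<^sup>2 + l\<^sub>2 * (A\<^sub>1 t / A\<^sub>2 t) + l\<^sub>3"
  shows "((\<exists>\<alpha>>0. isometric_up_to_shift_and_sign I (biaxial_metric e A\<^sub>1 A\<^sub>2)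
                     {0<..<pi / (2 * \<alpha>)} (fubini_study_metric e \<alpha>)) \<or>
          (\<exists>\<alpha>>0. isometric_up_to_shift_and_sign I (biaxial_metric e A\<^sub>1 A\<^sub>2)
                     {0<..} (hyperbolic_fubini_study_metric e \<alpha>))) \<and>
         ((k\<^sub>1, k\<^sub>2, k\<^sub>3, l\<^sub>1, l\<^sub>2, l\<^sub>3) = (2, 0, -1, 0, 1, 0) \<or>
          (k\<^sub>1, k\<^sub>2, k\<^sub>3, l\<^sub>1, l\<^sub>2, l\<^sub>3) = (-2, 0, 1, 0, -1, 0))"
proof -
  let ?g = "biaxial_metric e A\<^sub>1 A\<^sub>2"
  obtain D c where D: "levi_civita (I \<times> S3) ?g D"
    and ric: "\<And>X Y p. vector_field (I \<times> S3) X \<Longrightarrow> vector_field (I \<times> S3) Y \<Longrightarrow> p \<in> I \<times> S3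
      \<Longrightarrow> ricci (I \<times> S3) D X Y p = c * ?g p (X p) (Y p)"
    using einstein unfolding einstein_def by blast
  \<comment> \<open>With \<open>c = 0\<close> the connection \<open>D\<close> itself would witness
    Ricci-flatness.\<close>
  have c: "c \<noteq> 0"
    using not_ricci_flat D ric unfolding ricci_flat_def by fastforce
  define A where "A = (\<lambda>i::3. if i = 1 then A\<^sub>1 else A\<^sub>2)"
  interpret diagonal_metric e I A ?g D
  proof
    show "S3_coframe e" "open I" "levi_civita (I \<times> S3) ?g D" by fact+
    show "smooth_map I (A i)" for i using smooth by (simp add: A_def)
    show "A i t > 0" if "t \<in> I" for i t using pos[OF that] by (simp add: A_def)
    show "?g = (\<lambda>(t, p) (\<tau>, v) (\<sigma>, w). \<tau> * \<sigma> + (\<Sum>i\<in>UNIV. (A i t)\<^sup>2 * (e i p v * e i p w)))"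
      by (auto simp: fun_eq_iff biaxial_metric_def sum_3 A_def algebra_simps)
  qed
  interpret biaxial_ode I A\<^sub>1 A\<^sub>2 k\<^sub>1 k\<^sub>2 k\<^sub>3 l\<^sub>1 l\<^sub>2 l\<^sub>3 c
    by unfold_locales
      (rule interval pos ode1 ode2 c einstein_equations[OF ric A_def]
        smooth_map_deriv(1)[OF interval(1) smooth(1)] smooth_map_deriv(1)[OF interval(1) smooth(2)]; assumption?)+
  obtain s where s: "s \<in> {1, -1}" "k\<^sub>1 = 2 * s" "k\<^sub>2 = 0" "k\<^sub>3 = - s" "l\<^sub>1 = 0" "l\<^sub>2 = s" "l\<^sub>3 = 0"
    and A2: "\<And>t. t \<in> I \<Longrightarrow> (A\<^sub>2 has_real_derivative s * x t) (at t)"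
    and x2: "\<And>t. t \<in> I \<Longrightarrow> c * (A\<^sub>2 t)\<^sup>2 = 6 * (1 - (x t)\<^sup>2)"
    by (rule solution) (rule that)
  have coeffs: "(k\<^sub>1, k\<^sub>2, k\<^sub>3, l\<^sub>1, l\<^sub>2, l\<^sub>3) = (2, 0, -1, 0, 1, 0) \<or>
      (k\<^sub>1, k\<^sub>2, k\<^sub>3, l\<^sub>1, l\<^sub>2, l\<^sub>3) = (-2, 0, 1, 0, -1, 0)"
    using s by auto
  define \<alpha> where "\<alpha> = sqrt (\<bar>c\<bar> / 6)"
  have \<alpha>: "\<alpha> > 0" "\<alpha>\<^sup>2 = \<bar>c\<bar> / 6" using c by (auto simp: \<alpha>_def)
  consider "c > 0" | "c < 0" using c by linarith
  then show ?thesis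
  proof cases
    case 1
    have "c = 6 * \<alpha>\<^sup>2" using \<alpha>(2) 1 by simp
    then have "(x t)\<^sup>2 = 1 - (\<alpha> * A\<^sub>2 t)\<^sup>2" if "t \<in> I" for t
      using x2[OF that] unfolding power_mult_distrib by simp
    from trigonometric_solution[OF s(1) \<alpha>(1) A2 this] obtain C where
      "\<And>t. t \<in> I \<Longrightarrow> s * t + C \<in> {0<..<pi / (2 * \<alpha>)}"
      "\<And>t. t \<in> I \<Longrightarrow> A\<^sub>1 t = sin (2 * \<alpha> * (s * t + C)) / (2 * \<alpha>)"
      "\<And>t. t \<in> I \<Longrightarrow> A\<^sub>2 t = sin (\<alpha> * (s * t + C)) / \<alpha>" by blast
    then have "isometric_up_to_shift_and_sign I ?g {0<..<pi / (2 * \<alpha>)} (fubini_study_metric e \<alpha>)"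
      unfolding fubini_study_metric_def by (intro isometric_biaxial[OF interval(1) s(1)]) auto
    then show ?thesis using \<alpha>(1) coeffs by blast
  next
    case 2
    have "c = - 6 * \<alpha>\<^sup>2" using \<alpha>(2) 2 by simp
    then have "(x t)\<^sup>2 = 1 + (\<alpha> * A\<^sub>2 t)\<^sup>2" if "t \<in> I" for t
      using x2[OF that] unfolding power_mult_distrib by simp
    from hyperbolic_solution[OF s(1) \<alpha>(1) A2 this] obtain C where
      "\<And>t. t \<in> I \<Longrightarrow> s * t + C \<in> {0<..}"
      "\<And>t. t \<in> I \<Longrightarrow> A\<^sub>1 t = sinh (2 * \<alpha> * (s * t + C)) / (2 * \<alpha>)"
      "\<And>t. t \<in> I \<Longrightarrow> A\<^sub>2 t = sinh (\<alpha> * (s * t + C)) / \<alpha>" by blast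
    then have "isometric_up_to_shift_and_sign I ?g {0<..} (hyperbolic_fubini_study_metric e \<alpha>)"
      unfolding hyperbolic_fubini_study_metric_def by (intro isometric_biaxial[OF interval(1) s(1)]) auto
    then show ?thesis using \<alpha>(1) coeffs by blast
  qed
qed

end
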